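(* Let $Q$ be a quadrangulation of the polygon with $2n+2$ vertices. Then the oriented flip graph $\Gamma_Q$ is the Hasse diagram of a partial order on the set of $Q$-compatible quadrangulations.
   Context: Quadrangulations. Consider a regular polygon with $2n+2$ vertices ($n\ge 1$), numbered $0,\dots,2n+1$ clockwise (indices mod $2n+2$). A quadrangulation is a set of pairwise noncrossing diagonals cutting the polygon into quadrilaterals; there are then $n$ quadrilaterals, called squares, and $n-1$ diagonals, called inner edges. The $2n+2$ sides of the polygon are the boundary edges. Vertices are coloured alternately black and white; an edge (boundary or inner) always joins a white and a black vertex and is oriented from white to black. Compatibility. Fix a quadrangulation $Q$, drawn in a "blue" polygon with vertices $b_0,\dots,b_{2n+1}$. Let the "red" polygon, with vertices $r_0,\dots,r_{2n+1}$, be the blue one rotated clockwise by the angle $2\pi/(4n+4)$, so that the clockwise order on the circle is $b_0,r_0,b_1,r_1,\dots,b_{2n+1},r_{2n+1}$; $r_i$ has the same colour as $b_i$. A red edge is compatible with a blue edge if either they do not cross, or they cross and the pair (direction of the red edge, direction of the blue edge) is a positively oriented basis of the plane. A red edge is $Q$-compatible if it is compatible with all edges of $Q$. A $Q$-compatible quadrangulation is a quadrangulation $Q'$ of the red polygon all of whose edges are $Q$-compatible. (None of this depends on which of the two alternating colourings is chosen.) Flips. For a $Q$-compatible quadrangulation $Q'$ and an inner edge $i$ of $Q'$, there is exactly one other inner edge $j$ such that $(Q'\setminus\{i\})\cup\{j\}$ is a $Q$-compatible quadrangulation; replacing $i$ by $j$ is a flip. The flip takes place in the hexagon $H$ formed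 by the two squares of $Q'$ adjacent to $i$. There is always an inner edge of $Q$ (a long inner edge) that crosses two opposite sides of $H$, entering (for its white-to-black orientation) through one and leaving through the opposite one; all long inner edges enter through the same side and leave through the same side. Of the two $Q$-compatible diagonals of $H$, one, called (id), has its white endpoint on the side through which long inner edges enter $H$, and the other, called (op), has its white endpoint on the side through which they leave $H$. The flip is oriented from the quadrangulation containing (id) to the quadrangulation containing (op). $\Gamma_Q$ is the directed graph whose vertices are the $Q$-compatible quadrangulations and whose arrows are the oriented flips. A directed graph is the Hasse diagram of a partial order if its arrows are exactly the covering relations of the partial order; by convention the order decreases along arrows. *)

theory Defs
  imports "HOL-Analysis.Analysis"
begin

text \<open>
  The polygon has the vertex labels \<open>0, \<dots>, 2 n + 1\<close>.  An edge or diagonal is the two-element set of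
  the labels of its endpoints; it is turned into a segment of the complex plane by a placement
  \<open>p :: nat \<Rightarrow> complex\<close> of the vertices, which is either that of the blue or that of the red polygon.
  Clockwise means by negative angles.
\<close>

definition blue :: "nat \<Rightarrow> nat \<Rightarrow> complex" where
  "blue n k = cis (- (2 * pi * real k / real (2 * n + 2)))"

definition red :: "nat \<Rightarrow> nat \<Rightarrow> complex" where
  "red n k = cis (- (2 * pi / real (4 * n + 4))) * blue n k"

definition verts :: "nat \<Rightarrow> nat set" where
  "verts n = {0..<2 * n + 2}"

text \<open>
  Since the labels increase clockwise, the sides of the convex polygon spanned by a set \<open>S\<close> of labels
  join cyclically consecutive elements of \<open>S\<close>.  The index \<open>k\<close> is read modulo \<open>card S\<close>.
\<close>

definition side :: "nat set \<Rightarrow> nat \<Rightarrow> nat set" where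
  "side S k = {sorted_list_of_set S ! (k mod card S), sorted_list_of_set S ! (Suc k mod card S)}"

definition boundary_edges :: "nat \<Rightarrow> nat set set" where
  "boundary_edges n = range (side (verts n))"

definition diagonals :: "nat \<Rightarrow> nat set set" where
  "diagonals n = {e. e \<subseteq> verts n \<and> card e = 2 \<and> e \<notin> boundary_edges n}"

definition open_edge :: "(nat \<Rightarrow> complex) \<Rightarrow> nat set \<Rightarrow> complex set" where
  "open_edge p e = rel_interior (convex hull (p ` e))"

definition crosses :: "(nat \<Rightarrow> complex) \<Rightarrow> nat set \<Rightarrow> (nat \<Rightarrow> complex) \<Rightarrow> nat set \<Rightarrow> bool" where
  "crosses p e q f \<longleftrightarrow> open_edge p e \<inter> open_edge q f \<noteq> {}"

definition cells :: "(nat \<Rightarrow> complex) \<Rightarrow> nat \<Rightarrow> nat set set \<Rightarrow> complex set set" where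
  "cells p n D =
     components (interior (convex hull (p ` verts n)) - (\<Union>e\<in>D. convex hull (p ` e)))"

definition squares :: "(nat \<Rightarrow> complex) \<Rightarrow> nat \<Rightarrow> nat set set \<Rightarrow> nat set set" where
  "squares p n D =
     {S. S \<subseteq> verts n \<and> card S = 4 \<and> interior (convex hull (p ` S)) \<in> cells p n D}"

definition quadrangulation :: "(nat \<Rightarrow> complex) \<Rightarrow> nat \<Rightarrow> nat set set \<Rightarrow> bool" where
  "quadrangulation p n D \<longleftrightarrow>
     D \<subseteq> diagonals n \<and>
     pairwise (\<lambda>e f. \<not> crosses p e p f) D \<and>
     cells p n D = (\<lambda>S. interior (convex hull (p ` S))) ` squares p n D"

definition edges :: "nat \<Rightarrow> nat set set \<Rightarrow> nat set set" where
  "edges n D = boundary_edges n \<union> D"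

definition alternating_colouring :: "nat \<Rightarrow> (nat \<Rightarrow> bool) \<Rightarrow> bool" where
  "alternating_colouring n wh \<longleftrightarrow>
     (\<forall>k\<in>verts n. wh (Suc k mod (2 * n + 2)) \<longleftrightarrow> \<not> wh k)"

text \<open>
  A vertex \<open>v\<close> is white if \<open>wh v\<close> and black otherwise.  The following three are meaningful
  for edges with one endpoint of each colour, as all edges of a quadrangulation are.
\<close>

definition white_end :: "(nat \<Rightarrow> bool) \<Rightarrow> nat set \<Rightarrow> nat" where
  "white_end wh e = (THE v. v \<in> e \<and> wh v)"

definition black_end :: "(nat \<Rightarrow> bool) \<Rightarrow> nat set \<Rightarrow> nat" where
  "black_end wh e = (THE v. v \<in> e \<and> \<not> wh v)"

definition direction :: "(nat \<Rightarrow> complex) \<Rightarrow> (nat \<Rightarrow> bool) \<Rightarrow> nat set \<Rightarrow> complex" where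
  "direction p wh e = p (black_end wh e) - p (white_end wh e)"

text \<open>\<open>Im (cnj u * v) = Re u * Im v - Im u * Re v\<close> is the determinant of the pair \<open>(u, v)\<close>.\<close>

definition positive_basis :: "complex \<Rightarrow> complex \<Rightarrow> bool" where
  "positive_basis u v \<longleftrightarrow> Im (cnj u * v) > 0"

definition compatible :: "nat \<Rightarrow> (nat \<Rightarrow> bool) \<Rightarrow> nat set \<Rightarrow> nat set \<Rightarrow> bool" where
  "compatible n wh e f \<longleftrightarrow>
     (crosses (red n) e (blue n) f \<longrightarrow>
      positive_basis (direction (red n) wh e) (direction (blue n) wh f))"

definition compatible_edge :: "nat \<Rightarrow> (nat \<Rightarrow> bool) \<Rightarrow> nat set set \<Rightarrow> nat set \<Rightarrow> bool" where
  "compatible_edge n wh Q e \<longleftrightarrow> (\<forall>f\<in>edges n Q. compatible n wh e f)"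

definition compatible_quadrangulations ::
    "nat \<Rightarrow> (nat \<Rightarrow> bool) \<Rightarrow> nat set set \<Rightarrow> nat set set set" where
  "compatible_quadrangulations n wh Q =
     {Q'. quadrangulation (red n) n Q' \<and> (\<forall>e\<in>edges n Q'. compatible_edge n wh Q e)}"

definition flip_hexagon :: "nat \<Rightarrow> nat set set \<Rightarrow> nat set \<Rightarrow> nat set \<Rightarrow> bool" where
  "flip_hexagon n Q' i H \<longleftrightarrow>
     (\<exists>S\<in>squares (red n) n Q'. \<exists>T\<in>squares (red n) n Q'.
        S \<noteq> T \<and> i \<subseteq> S \<and> i \<subseteq> T \<and> H = S \<union> T)"

definition opposite_sides :: "nat set \<Rightarrow> nat set \<Rightarrow> nat set \<Rightarrow> bool" where
  "opposite_sides H s t \<longleftrightarrow> card H = 6 \<and> (\<exists>k. s = side H k \<and> t = side H (k + 3))"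

text \<open>The blue edge \<open>d\<close>, followed from white to black, crosses the red edge \<open>s\<close> before \<open>t\<close>.\<close>

definition crosses_before :: "nat \<Rightarrow> (nat \<Rightarrow> bool) \<Rightarrow> nat set \<Rightarrow> nat set \<Rightarrow> nat set \<Rightarrow> bool" where
  "crosses_before n wh d s t \<longleftrightarrow>
     (\<exists>x y. 0 < x \<and> x < y \<and> y < 1 \<and>
        linepath (blue n (white_end wh d)) (blue n (black_end wh d)) x \<in> open_edge (red n) s \<and>
        linepath (blue n (white_end wh d)) (blue n (black_end wh d)) y \<in> open_edge (red n) t)"

text \<open>
  The arrows of the oriented flip graph.  Here \<open>d\<close> is a long inner edge, entering the hexagon \<open>H\<close>
  through \<open>s\<close> and leaving it through \<open>t\<close>, so that \<open>i\<close> is the diagonal (id) and \<open>j\<close> the diagonal (op).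
\<close>

definition oriented_flip ::
    "nat \<Rightarrow> (nat \<Rightarrow> bool) \<Rightarrow> nat set set \<Rightarrow> nat set set \<Rightarrow> nat set set \<Rightarrow> bool" where
  "oriented_flip n wh Q Q' Q'' \<longleftrightarrow>
     Q' \<in> compatible_quadrangulations n wh Q \<and>
     Q'' \<in> compatible_quadrangulations n wh Q \<and>
     (\<exists>i j H. i \<in> Q' \<and> j \<notin> Q' \<and> Q'' = insert j (Q' - {i}) \<and> flip_hexagon n Q' i H \<and>
        (\<exists>d\<in>Q. \<exists>s t. opposite_sides H s t \<and> crosses_before n wh d s t \<and>
           white_end wh i \<in> s \<and> white_end wh j \<in> t))"

definition flip_graph ::
    "nat \<Rightarrow> (nat \<Rightarrow> bool) \<Rightarrow> nat set set \<Rightarrow> (nat set set \<times> nat set set) set" where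
  "flip_graph n wh Q = {(Q', Q''). oriented_flip n wh Q Q' Q''}"

definition covering_relations :: "('a \<times> 'a) set \<Rightarrow> ('a \<times> 'a) set" where
  "covering_relations r =
     {(x, y). (x, y) \<in> r \<and> x \<noteq> y \<and> \<not> (\<exists>z. z \<noteq> x \<and> z \<noteq> y \<and> (x, z) \<in> r \<and> (z, y) \<in> r)}"

text \<open>
  A pair \<open>(x, y)\<close> in the order relation means that \<open>x\<close> is below \<open>y\<close>; as the order decreases along
  arrows, an arrow from \<open>x\<close> to \<open>y\<close> stands for \<open>x\<close> covering \<open>y\<close>.
\<close>

definition is_hasse_diagram_of :: "('a \<times> 'a) set \<Rightarrow> ('a \<times> 'a) set \<Rightarrow> bool" where
  "is_hasse_diagram_of G r \<longleftrightarrow> G = (covering_relations r)\<inverse>"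

end

theory Submission
  imports Defs
begin

text \<open>
  The idea is to attach to every compatible quadrangulation a set, its shadow, that strictly shrinks
  along every oriented flip and that remembers which edge was flipped.

  Follow an edge \<open>d\<close> of \<open>Q\<close> from its white end \<open>w\<close> to its black end \<open>b\<close>.  By compatibility every red edge
  that crosses \<open>d\<close> has its white end on the left and its black end on the right of \<open>d\<close>.  So the red
  edges of a compatible quadrangulation that cross \<open>d\<close> are pairs in a product of two linear orders, and since
  they do not cross each other, they form a chain from \<open>w\<close> to \<open>b\<close>, drawn as a monotone staircase.  The
  shadow consists of all pairs on one side of these staircases.  In the hexagon \<open>v0, \<dots>, v5\<close> of an
  oriented flip, a long inner edge \<open>d\<close> enters through \<open>{v0, v1}\<close> and leaves through \<open>{v3, v4}\<close>, and the
  diagonal \<open>{v1, v4}\<close> is replaced by \<open>{v0, v3}\<close>.  For \<open>d\<close> this turns one corner of the staircase to the other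
  side; for every other edge of \<open>Q\<close> the shadow does not grow (\<open>flip_shadow_mono\<close>), and for \<open>d\<close> it loses
  the pair \<open>(v1, v4)\<close> of ends of the removed diagonal (\<open>flip_shadow_strict\<close>).  Hence the flip graph has no
  oriented cycle, and reachability is a partial order.

  It remains to see that an arrow from \<open>x\<close> to \<open>y\<close> is never bypassed by a longer path
  (\<open>flip_no_shortcut\<close>).  The first step of such a path removes an edge \<open>i\<close> of \<open>x\<close> and deletes the pair of ends
  of \<open>i\<close> from the shadow for good.  Hence \<open>i\<close> is not an edge of \<open>y\<close>, so the arrow from \<open>x\<close> to \<open>y\<close> is a
  flip at \<open>i\<close> too, and both flips coincide (\<open>flip_at_unique\<close>).

  To reach these combinatorial arguments, the geometry is reduced to the clockwise order of labels.  The
  points of a circle are in convex position, so that crossing of chords means interlacing of labels.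
  For a quadrangulation, given by the components of the complement of its diagonals, the facts needed
  are that the sides of a square are edges (\<open>side_of_square_is_edge\<close>), that an inner edge has exactly
  one square on either side (\<open>square_at_edge\<close>, \<open>square_at_edge_unique\<close>), that edges join vertices of
  different colours (\<open>edge_colours\<close>), and that an exchanged diagonal stays in the hexagon of the
  removed one (\<open>flip_replacement\<close>).
\<close>

section \<open>Cyclic order\<close>

text \<open>
  The strict clockwise order of three labels on a circle.  Being a predicate on labels, it turns all
  later incidence arguments into statements without geometry.
\<close>
definition cyc :: "nat \<Rightarrow> nat \<Rightarrow> nat \<Rightarrow> bool" where
  "cyc a b c \<longleftrightarrow> a < b \<and> b < c \<or> b < c \<and> c < a \<or> c < a \<and> a < b"

lemma cyc_rotate: "cyc a b c \<longleftrightarrow> cyc b c a"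
  by (auto simp: cyc_def)

lemma cyc_distinct: "cyc a b c \<Longrightarrow> a \<noteq> b \<and> b \<noteq> c \<and> a \<noteq> c"
  by (auto simp: cyc_def)

lemma cyc_total: "a \<noteq> b \<Longrightarrow> b \<noteq> c \<Longrightarrow> a \<noteq> c \<Longrightarrow> cyc a b c \<or> cyc a c b"
  by (auto simp: cyc_def)

lemma cyc_asym: "cyc a b c \<Longrightarrow> \<not> cyc a c b"
  by (auto simp: cyc_def)

definition cyc4 :: "nat \<Rightarrow> nat \<Rightarrow> nat \<Rightarrow> nat \<Rightarrow> bool" where
  "cyc4 a b c d \<longleftrightarrow> cyc a b c \<and> cyc a c d"

lemma cyc4_rotate: "cyc4 a b c d \<Longrightarrow> cyc4 b c d a"
  unfolding cyc4_def cyc_def by linarith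

lemma cyc4_triples:
  assumes "cyc4 a b c d"
  shows "cyc a b c" "cyc a b d" "cyc a c d" "cyc b c d"
  using assms unfolding cyc4_def cyc_def by linarith+

lemma cyc4_all:
  assumes "cyc4 a b c d"
  shows "cyc a b c" "cyc b c a" "cyc c a b" "cyc a b d" "cyc b d a" "cyc d a b"
    "cyc a c d" "cyc c d a" "cyc d a c" "cyc b c d" "cyc c d b" "cyc d b c"
  using cyc4_triples[OF assms] cyc_rotate by blast+

lemma cyc_trans:
  assumes "cyc a b c" "cyc a c d"
  shows "cyc a b d" "cyc b c d" "cyc c d b"
proof -
  have "cyc4 a b c d" using assms by (simp add: cyc4_def)
  then show "cyc a b d" "cyc b c d" "cyc c d b" by (auto dest: cyc4_all)
qed

lemma cyc4I: "cyc a b c \<Longrightarrow> cyc c d a \<Longrightarrow> cyc4 a b c d"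
  by (simp add: cyc4_def cyc_rotate[of c d a] cyc_rotate[of d a c])

text \<open>
  Comparing \<open>v\<close> with \<open>b\<close>, \<open>c\<close> and \<open>d\<close> in the linear order seen from \<open>a\<close> locates it in one arc.
\<close>
lemma cyc4_arcs:
  assumes "cyc4 a b c d" "v \<notin> {a, b, c, d}"
  shows "cyc a v b \<or> cyc b v c \<or> cyc c v d \<or> cyc d v a"
proof -
  have "cyc a v b \<or> cyc a b v" "cyc a v c \<or> cyc a c v" "cyc a v d \<or> cyc a d v"
    using assms(2) cyc4_all[OF assms(1), THEN cyc_distinct]
      cyc_total[of a b v] cyc_total[of a c v] cyc_total[of a d v] by auto
  then show ?thesis
    using cyc_trans[of a b v] cyc_trans[of a c v] cyc_rotate[of d v a] cyc_rotate[of a d v] by blast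
qed

text \<open>
  With \<open>u\<close> in the arc from \<open>a\<close> to \<open>b\<close> and \<open>v\<close> in the opposite arc from \<open>c\<close> to \<open>d\<close>, the clockwise order
  is \<open>a, u, b, c, v, d\<close>.  This describes a chord from \<open>u\<close> to \<open>v\<close> through two opposite sides of a hexagon.
\<close>
lemma arcs_order:
  assumes "cyc4 a b c d" "cyc a u b" "cyc c v d"
  shows "cyc u b c" "cyc u c v" "cyc u v d" "cyc u d a" "cyc u b v" "cyc u v a"
proof -
  have abc: "cyc a b c" and cda: "cyc c d a" using cyc4_all[OF assms(1)] by blast+
  show ubc: "cyc u b c" using cyc_trans[OF assms(2) abc] by blast
  have auc: "cyc a u c" using cyc_trans[OF assms(2) abc] by blast
  have "cyc c v a" "cyc v d a" using cyc_trans[OF assms(3) cda] by blast+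
  then have acv: "cyc a c v" and avd: "cyc a v d" using cyc_rotate by blast+
  show ucv: "cyc u c v" using cyc_trans[OF auc acv] by blast
  have auv: "cyc a u v" using cyc_trans[OF auc acv] by blast
  show "cyc u v d" using cyc_trans[OF auv avd] by blast
  have "cyc a u d" using cyc_trans[OF auv avd] by blast
  then show "cyc u d a" using cyc_rotate by blast
  show "cyc u v a" using auv cyc_rotate by blast
  show "cyc u b v" using cyc_trans[OF ubc ucv] by blast
qed

text \<open>
  No label lies strictly between \<open>k\<close> and its successor, so every other one comes after both.
\<close>
lemma cyc_Suc:
  assumes "k < M" "c < M" "c \<noteq> k" "c \<noteq> Suc k mod M"
  shows "cyc k (Suc k mod M) c"
  using assms by (cases "Suc k = M") (auto simp: cyc_def)

definition interlace :: "nat \<Rightarrow> nat \<Rightarrow> nat \<Rightarrow> nat \<Rightarrow> bool" where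
  "interlace a b c d \<longleftrightarrow> cyc4 a c b d \<or> cyc4 a d b c"

lemma interlace_commute:
  "interlace a b c d \<longleftrightarrow> interlace c d a b" "interlace a b c d \<longleftrightarrow> interlace b a c d"
  "interlace a b c d \<longleftrightarrow> interlace a b d c"
  unfolding interlace_def using cyc4_rotate by blast+

lemma interlace_cyc:
  assumes "interlace a b c d"
  shows "cyc a c b \<and> cyc a b d \<or> cyc a d b \<and> cyc a b c"
  using assms unfolding interlace_def cyc4_def by blast

text \<open>
  The red vertex \<open>k\<close> will be the point \<open>2 * k + 1\<close> of a finer subdivision of the circle.
\<close>
lemma cyc_odd [simp]: "cyc (2 * a + 1) (2 * b + 1) (2 * c + 1) = cyc a b c"
  unfolding cyc_def by auto

lemma cyc4_odd: "cyc4 (2 * a + 1) (2 * b + 1) (2 * c + 1) (2 * d + 1) = cyc4 a b c d"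
  unfolding cyc4_def cyc_odd ..

section \<open>Oriented areas in the plane\<close>

text \<open>
  Twice the oriented area of the triangle, positive if the corners \<open>a\<close>, \<open>b\<close>, \<open>z\<close> are met clockwise,
  that is, if \<open>z\<close> lies to the right of the line from \<open>a\<close> to \<open>b\<close>.  It is affine in \<open>z\<close>, and its
  nonnegativity describes the side of a line on which a clockwise convex polygon lies.
\<close>
definition turn :: "complex \<Rightarrow> complex \<Rightarrow> complex \<Rightarrow> real" where
  "turn a b z = Im (cnj (z - a) * (b - a))"

lemma turn_inner: "turn a b z = inner (Complex (Im (b - a)) (- Re (b - a))) (z - a)"
  by (simp add: turn_def inner_complex_def algebra_simps)

lemma turn_rotate: "turn a b c = turn b c a"
  by (simp add: turn_def algebra_simps)

lemma turn_swap: "turn b a c = - turn a b c"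
  by (simp add: turn_def algebra_simps)

lemma turn_refl [simp]: "turn a b a = 0" "turn a b b = 0" "turn a a c = 0"
  by (simp_all add: turn_def algebra_simps)

lemma turn_affine:
  "turn a b ((1 - t) *\<^sub>R x + t *\<^sub>R y) = (1 - t) * turn a b x + t * turn a b y"
  by (simp add: turn_def algebra_simps)

text \<open>
  All three sines are positive for \<open>x < y < z < x + 2 * pi\<close>, so the corners of an inscribed triangle
  with angles in this order are met clockwise.
\<close>
lemma turn_cis:
  "turn (cis (- x)) (cis (- y)) (cis (- z)) =
    4 * sin ((y - x) / 2) * sin ((z - y) / 2) * sin ((z - x) / 2)"
proof -
  define u v where "u = (y - x) / 2" and "v = (z - y) / 2"
  have uv: "(z - x) / 2 = u + v" "y - x = 2 * u" "z - y = 2 * v" "z - x = 2 * (u + v)"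
    by (auto simp: u_def v_def field_simps)
  have "turn (cis (- x)) (cis (- y)) (cis (- z)) = sin (y - x) + sin (z - y) - sin (z - x)"
    by (simp add: turn_def sin_diff algebra_simps)
  also have "\<dots> = 2 * sin u * cos u + 2 * sin v * cos v - 2 * sin (u + v) * cos (u + v)"
    unfolding uv sin_double by simp
  also have "\<dots> = 4 * sin u * sin v * sin (u + v)"
  proof -
    have "(cos u)\<^sup>2 = 1 - (sin u)\<^sup>2" "(cos v)\<^sup>2 = 1 - (sin v)\<^sup>2"
      by (simp_all add: cos_squared_eq)
    then show ?thesis
      unfolding sin_add cos_add by algebra
  qed
  finally show ?thesis by (simp only: uv(1) u_def v_def)
qed

lemma continuous_on_turn: "continuous_on UNIV (turn a b)"
  unfolding turn_inner by (intro continuous_intros)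

lemma open_turn_pos: "open {z. 0 < turn a b z}"
  by (intro open_Collect_less continuous_on_turn continuous_on_const)

lemma convex_turn_nonneg: "convex {z. 0 \<le> turn a b z}"
proof -
  let ?c = "Complex (Im (b - a)) (- Re (b - a))"
  have "{z. 0 \<le> turn a b z} = {z. inner ?c z \<ge> inner ?c a}"
    unfolding turn_inner inner_diff_right by auto
  then show ?thesis by (simp only: convex_halfspace_ge)
qed

lemma interior_turn_nonneg:
  assumes "a \<noteq> b"
  shows "interior {z. 0 \<le> turn a b z} = {z. 0 < turn a b z}"
proof -
  let ?c = "Complex (Im (b - a)) (- Re (b - a))"
  have c: "?c \<noteq> 0" using assms by (auto simp: complex_eq_iff)
  have "{z. 0 \<le> turn a b z} = {z. inner ?c z \<ge> inner ?c a}"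
    "{z. 0 < turn a b z} = {z. inner ?c z > inner ?c a}"
    unfolding turn_inner inner_diff_right by auto
  then show ?thesis using interior_halfspace_ge[OF c] by simp
qed

text \<open>
  The three oriented areas seen from \<open>z\<close>, divided by the whole area, are the barycentric coordinates.
\<close>
lemma triangle_hull:
  assumes A: "turn a b c > 0" and z: "turn a b z \<ge> 0" "turn b c z \<ge> 0" "turn c a z \<ge> 0"
  shows "z \<in> convex hull {a, b, c}"
proof -
  let ?A = "turn a b c"
  have sum: "turn b c z + turn c a z + turn a b z = ?A"
    by (simp add: turn_def algebra_simps)
  have "?A *\<^sub>R z = turn b c z *\<^sub>R a + turn c a z *\<^sub>R b + turn a b z *\<^sub>R c"
    by (simp add: turn_def complex_eq_iff) algebra
  then have "z = (turn b c z / ?A) *\<^sub>R a + (turn c a z / ?A) *\<^sub>R b + (turn a b z / ?A) *\<^sub>R c"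
    using A by (simp add: divideR_right[symmetric] scaleR_right_distrib[symmetric] field_simps
        eq_vector_fraction_iff vector_fraction_eq_iff)
  moreover have "turn b c z / ?A + turn c a z / ?A + turn a b z / ?A = 1"
    using A sum by (simp add: add_divide_distrib[symmetric])
  moreover have "turn b c z / ?A \<ge> 0" "turn c a z / ?A \<ge> 0" "turn a b z / ?A \<ge> 0"
    using A z by simp_all
  ultimately show ?thesis unfolding convex_hull_3 by blast
qed

text \<open>
  If the end points of each segment are strictly separated by the line through the other one, the two
  lines meet at a point inside both segments; it is computed from the oriented areas.
\<close>
lemma segments_meet:
  assumes "turn a b c < 0" "turn a b d > 0" "turn c d a > 0" "turn c d b < 0"
  shows "open_segment a b \<inter> open_segment c d \<noteq> {}"
proof -
  let ?D = "turn a b d - turn a b c"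
  have D: "?D > 0" "turn c d a - turn c d b = ?D"
    using assms by (simp_all add: turn_def algebra_simps)
  define t where "t = - turn a b c / ?D"
  define s where "s = turn c d a / ?D"
  have t: "0 < t" "t < 1" and s: "0 < s" "s < 1"
    using assms D unfolding t_def s_def by (auto simp: field_simps)
  have tD: "t * ?D = - turn a b c" and sD: "s * ?D = turn c d a"
    using D(1) unfolding t_def s_def by simp_all
  let ?z = "(1 - t) *\<^sub>R c + t *\<^sub>R d"
  have "?D *\<^sub>R ?z = ?D *\<^sub>R c + (t * ?D) *\<^sub>R (d - c)"
    by (simp add: algebra_simps)
  also have "\<dots> = ?D *\<^sub>R a + (s * ?D) *\<^sub>R (b - a)"
    unfolding tD sD by (simp add: turn_def complex_eq_iff) algebra
  also have "\<dots> = ?D *\<^sub>R ((1 - s) *\<^sub>R a + s *\<^sub>R b)"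
    by (simp add: algebra_simps)
  finally have z: "?z = (1 - s) *\<^sub>R a + s *\<^sub>R b"
    using D(1) by simp
  have "c \<noteq> d" "a \<noteq> b" using assms by auto
  then have "?z \<in> open_segment c d" "?z \<in> open_segment a b"
    using t s z by (auto simp: in_segment)
  then show ?thesis by blast
qed

section \<open>Points in convex position\<close>

text \<open>
  Finitely many points in convex position, numbered clockwise.  Which side of a line
  through two of them contains a third one depends on the cyclic order of the indices only.
\<close>
locale clockwise =
  fixes p :: "nat \<Rightarrow> complex" and N :: nat
  assumes N: "3 \<le> N"
    and turn_increasing: "\<And>a b c. a < b \<Longrightarrow> b < c \<Longrightarrow> c < N \<Longrightarrow> 0 < turn (p a) (p b) (p c)"
begin

lemma turn_cyc:
  assumes "cyc a b c" "a < N" "b < N" "c < N"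
  shows "0 < turn (p a) (p b) (p c)"
  using assms turn_increasing[of a b c] turn_increasing[of b c a] turn_increasing[of c a b]
  unfolding cyc_def
  by (auto simp: turn_rotate[of "p a" "p b" "p c"] turn_rotate[of "p c" "p a" "p b"])

lemma turn_cyc_neg:
  assumes "cyc a c b" "a < N" "b < N" "c < N"
  shows "turn (p a) (p b) (p c) < 0"
  using turn_cyc[of a c b] assms turn_swap[of "p a" "p c" "p b"] turn_rotate[of "p a" "p b" "p c"]
    turn_rotate[of "p b" "p c" "p a"] by simp

lemma turn_sign:
  assumes "a < N" "b < N" "c < N"
  obtains "cyc a b c" "\<not> cyc a c b" "0 < turn (p a) (p b) (p c)"
  | "cyc a c b" "\<not> cyc a b c" "turn (p a) (p b) (p c) < 0"
  | "\<not> cyc a b c" "\<not> cyc a c b" "a = b \<or> b = c \<or> c = a" "turn (p a) (p b) (p c) = 0"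
  using turn_cyc[of a b c] turn_cyc_neg[of a c b] cyc_total[of a b c] cyc_asym[of a b c]
    cyc_asym[of a c b] turn_refl(1)[of "p a" "p b"] turn_refl(2)[of "p a" "p b"]
    turn_refl(3)[of "p a" "p c"] assms by fastforce

lemma turn_pos_iff:
  assumes "a < N" "b < N" "c < N"
  shows "0 < turn (p a) (p b) (p c) \<longleftrightarrow> cyc a b c"
  using assms by (cases rule: turn_sign[of a b c]) auto

lemma turn_neg_iff:
  assumes "a < N" "b < N" "c < N"
  shows "turn (p a) (p b) (p c) < 0 \<longleftrightarrow> cyc a c b"
  using assms by (cases rule: turn_sign[of a b c]) auto

lemma turn_zero_iff:
  assumes "a < N" "b < N" "c < N" "a \<noteq> b"
  shows "turn (p a) (p b) (p c) = 0 \<longleftrightarrow> c = a \<or> c = b"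
  using assms by (cases rule: turn_sign[of a b c]) auto

lemma vertex_inj:
  assumes "a < N" "b < N" "p a = p b" shows "a = b"
proof (rule ccontr)
  assume "a \<noteq> b"
  obtain c where "c < N" "c \<noteq> a" "c \<noteq> b"
  proof -
    have "0 < N" "1 < N" "2 < N" using N by auto
    moreover have "(0 \<noteq> a \<and> 0 \<noteq> b) \<or> (1 \<noteq> a \<and> 1 \<noteq> b) \<or> (2 \<noteq> a \<and> 2 \<noteq> b)" by linarith
    ultimately show ?thesis using that by metis
  qed
  then show False using turn_zero_iff[of a b c] assms \<open>a \<noteq> b\<close> by simp
qed

lemma crosses_if_interlace:
  assumes "a < N" "b < N" "c < N" "d < N" "interlace a b c d"
  shows "open_segment (p a) (p b) \<inter> open_segment (p c) (p d) \<noteq> {}"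
proof -
  have *: "open_segment (p a) (p b) \<inter> open_segment (p c) (p d) \<noteq> {}"
    if "cyc4 a c b d" "a < N" "b < N" "c < N" "d < N" for a b c d
  proof (rule segments_meet)
    show "turn (p a) (p b) (p c) < 0" "turn (p a) (p b) (p d) > 0"
      "turn (p c) (p d) (p a) > 0" "turn (p c) (p d) (p b) < 0"
      using cyc4_all[OF that(1)] that by (simp_all add: turn_pos_iff turn_neg_iff)
  qed
  show ?thesis
    using assms *[of a c b d] *[of a d b c] unfolding interlace_def
    by (metis open_segment_commute)
qed

text \<open>
  The two end points of a segment through an inner point of a chord lie strictly on different sides of
  the chord, since a vertex on the line of a chord is an end point of the chord.
\<close>
lemma interlace_if_meet:
  assumes z: "z \<in> open_segment (p a) (p b)" "z \<in> closed_segment (p c) (p d)"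
    and lt: "a < N" "b < N" "c < N" "d < N" and ne: "a \<noteq> b" "c \<noteq> d" "{a, b} \<noteq> {c, d}"
  shows "interlace a b c d"
proof -
  obtain t where t: "0 \<le> t" "t \<le> 1" "z = (1 - t) *\<^sub>R p c + t *\<^sub>R p d"
    using z(2) by (auto simp: in_segment)
  obtain s where "z = (1 - s) *\<^sub>R p a + s *\<^sub>R p b"
    using z(1) by (auto simp: in_segment)
  then have "turn (p a) (p b) z = 0" by (simp add: turn_affine)
  then have eq: "(1 - t) * turn (p a) (p b) (p c) + t * turn (p a) (p b) (p d) = 0"
    using t by (simp add: turn_affine)
  have nz: "z \<noteq> p a" "z \<noteq> p b" using z(1) by (auto simp: open_segment_def)
  have "t \<noteq> 0"
    using eq t nz turn_zero_iff[of a b c] lt ne by auto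
  moreover have "t \<noteq> 1"
    using eq t nz turn_zero_iff[of a b d] lt ne by auto
  ultimately have t01: "0 < t" "t < 1" using t by auto
  let ?u = "turn (p a) (p b) (p c)" and ?v = "turn (p a) (p b) (p d)"
  have "?u \<noteq> 0"
    using eq t01 turn_zero_iff[of a b c] turn_zero_iff[of a b d] lt ne by auto
  then consider "?u > 0" | "?u < 0" by linarith
  then show ?thesis
  proof cases
    case 1
    then have "(1 - t) * ?u > 0" using t01 by simp
    then have "t * ?v < 0" using eq by linarith
    then have "?v < 0" using t01 by (simp add: mult_less_0_iff)
    then have "cyc a d b" "cyc a b c" using 1 turn_neg_iff turn_pos_iff lt by auto
    then show ?thesis unfolding interlace_def cyc4_def cyc_def by auto
  next
    case 2
    then have "(1 - t) * ?u < 0" using t01 by (simp add: mult_less_0_iff)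
    then have "t * ?v > 0" using eq by linarith
    then have "?v > 0" using t01 by (simp add: zero_less_mult_iff)
    then have "cyc a b d" "cyc a c b" using 2 turn_neg_iff turn_pos_iff lt by auto
    then show ?thesis unfolding interlace_def cyc4_def cyc_def by auto
  qed
qed

lemma open_edge_segment:
  assumes "a < N" "b < N" "a \<noteq> b"
  shows "open_edge p {a, b} = open_segment (p a) (p b)"
  using vertex_inj[of a b] assms
  by (auto simp: open_edge_def segment_convex_hull[symmetric] rel_interior_closed_segment)

text \<open>
  A quadrilateral is the union of the two triangles into which the diagonal from \<open>a\<close> to \<open>c\<close> cuts it.
\<close>
lemma quadrilateral_hull:
  assumes "cyc4 a b c d" "a < N" "b < N" "c < N" "d < N"
  shows "convex hull (p ` {a, b, c, d}) =
    {z. 0 \<le> turn (p a) (p b) z} \<inter> {z. 0 \<le> turn (p b) (p c) z} \<inter>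
    {z. 0 \<le> turn (p c) (p d) z} \<inter> {z. 0 \<le> turn (p d) (p a) z}" (is "_ = ?K")
proof
  note tr = cyc4_all[OF assms(1)]
  have pos: "turn (p a) (p b) (p c) > 0" "turn (p a) (p b) (p d) > 0" "turn (p b) (p c) (p d) > 0"
    "turn (p b) (p c) (p a) > 0" "turn (p c) (p d) (p a) > 0" "turn (p c) (p d) (p b) > 0"
    "turn (p d) (p a) (p b) > 0" "turn (p d) (p a) (p c) > 0" "turn (p a) (p c) (p d) > 0"
    using tr assms by (simp_all add: turn_pos_iff)
  show "convex hull (p ` {a, b, c, d}) \<subseteq> ?K"
    by (intro hull_minimal convex_Int convex_turn_nonneg) (use pos in \<open>auto intro: less_imp_le\<close>)
  show "?K \<subseteq> convex hull (p ` {a, b, c, d})"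
  proof
    fix z assume z: "z \<in> ?K"
    show "z \<in> convex hull (p ` {a, b, c, d})"
    proof (cases "turn (p a) (p c) z \<le> 0")
      case True
      then have "z \<in> convex hull {p a, p b, p c}"
        using z pos by (intro triangle_hull) (auto simp: turn_swap[of "p c" "p a"])
      then show ?thesis using hull_mono[of "{p a, p b, p c}" "p ` {a, b, c, d}"] by auto
    next
      case False
      then have "z \<in> convex hull {p a, p c, p d}"
        using z pos by (intro triangle_hull) auto
      then show ?thesis using hull_mono[of "{p a, p c, p d}" "p ` {a, b, c, d}"] by auto
    qed
  qed
qed

lemma quadrilateral_interior:
  assumes "cyc4 a b c d" "a < N" "b < N" "c < N" "d < N"
  shows "interior (convex hull (p ` {a, b, c, d})) =
    {z. 0 < turn (p a) (p b) z} \<inter> {z. 0 < turn (p b) (p c) z} \<inter>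
    {z. 0 < turn (p c) (p d) z} \<inter> {z. 0 < turn (p d) (p a) z}"
proof -
  have "p a \<noteq> p b" "p b \<noteq> p c" "p c \<noteq> p d" "p d \<noteq> p a"
    using cyc4_all[OF assms(1), THEN cyc_distinct] vertex_inj assms by blast+
  then show ?thesis
    by (simp add: quadrilateral_hull[OF assms] interior_turn_nonneg del: image_insert)
qed

text \<open>
  A short step from an inner point of a side, to the side's inner half-plane, ends inside the
  quadrilateral, because the other three sides are at a positive distance.
\<close>
lemma eventually_inside:
  assumes q: "cyc4 a b c d" "a < N" "b < N" "c < N" "d < N"
    and z: "z \<in> open_segment (p a) (p b)" and y: "0 < turn (p a) (p b) y"
  shows "\<forall>\<^sub>F \<delta> in at_right 0. (1 - \<delta>) *\<^sub>R z + \<delta> *\<^sub>R y \<in> interior (convex hull (p ` {a, b, c, d}))"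
proof -
  obtain s where s: "0 < s" "s < 1" "z = (1 - s) *\<^sub>R p a + s *\<^sub>R p b"
    using z by (auto simp: in_segment)
  have pos: "turn (p b) (p c) (p a) > 0" "turn (p c) (p d) (p a) > 0" "turn (p c) (p d) (p b) > 0"
    "turn (p d) (p a) (p b) > 0"
    using cyc4_all[OF q(1)] q by (simp_all add: turn_pos_iff)
  let ?U = "{z. 0 < turn (p b) (p c) z} \<inter> {z. 0 < turn (p c) (p d) z} \<inter> {z. 0 < turn (p d) (p a) z}"
  have "z \<in> ?U"
    using s pos by (auto simp: turn_affine intro!: add_pos_pos mult_pos_pos)
  moreover have "open ?U" by (intro open_Int open_turn_pos)
  moreover have "((\<lambda>\<delta>. (1 - \<delta>) *\<^sub>R z + \<delta> *\<^sub>R y) \<longlongrightarrow> (1 - 0) *\<^sub>R z + 0 *\<^sub>R y) (at_right 0)"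
    by (intro tendsto_intros)
  ultimately have "\<forall>\<^sub>F \<delta> in at_right 0. (1 - \<delta>) *\<^sub>R z + \<delta> *\<^sub>R y \<in> ?U"
    by (intro topological_tendstoD) auto
  moreover have "\<forall>\<^sub>F \<delta> in at_right (0::real). 0 < \<delta> \<and> \<delta> < 1"
    by (rule eventually_at_rightI[of 0 1]) auto
  ultimately show ?thesis
  proof eventually_elim
    case (elim \<delta>)
    have "turn (p a) (p b) z = 0" using s by (simp add: turn_affine)
    then have "turn (p a) (p b) ((1 - \<delta>) *\<^sub>R z + \<delta> *\<^sub>R y) > 0"
      using elim y by (simp add: turn_affine)
    then show ?case using elim unfolding quadrilateral_interior[OF q] by auto
  qed
qed

text \<open>
  The two sides are opposite, so the oriented distance to one of them is positive where the line from
  \<open>p u\<close> to \<open>p v\<close> passes through the other.  Since this distance is affine along the line and vanishes at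
  the crossing of its own side, it changes its sign there; hence \<open>u\<close> lies behind the side crossed
  first and \<open>v\<close> behind the side crossed last.
\<close>
lemma crossing_order:
  assumes q: "cyc4 a b c d" and lt: "a < N" "b < N" "c < N" "d < N" "u < N" "v < N"
    and xy: "0 < x" "x < y" "y < 1"
    and x: "linepath (p u) (p v) x \<in> open_segment (p a) (p b)"
    and y: "linepath (p u) (p v) y \<in> open_segment (p c) (p d)"
  shows "cyc a u b \<and> cyc c v d"
proof -
  have between: "0 < turn (p e) (p f) z \<and> turn (p g) (p h) z = 0"
    if z: "z \<in> open_segment (p g) (p h)" and "cyc e f g" "cyc e f h" "e < N" "f < N" "g < N" "h < N" for e f g h z
  proof -
    obtain t where t: "0 < t" "t < 1" "z = (1 - t) *\<^sub>R p g + t *\<^sub>R p h"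
      using z by (auto simp: in_segment)
    have "0 < turn (p e) (p f) (p g)" "0 < turn (p e) (p f) (p h)" using turn_cyc that by blast+
    then show ?thesis using t by (auto simp: turn_affine intro!: add_pos_pos)
  qed
  \<comment> \<open>An affine function that is positive at \<open>x\<close> and zero at a later \<open>y\<close> is negative at the end.\<close>
  have drop: "g1 < 0" if "(1 - x) * g0 + x * g1 > 0" "(1 - y) * g0 + y * g1 = 0"
    "0 < x" "x < y" "y < 1" for g0 g1 x y :: real
  proof (rule ccontr)
    assume "\<not> g1 < 0"
    have "(y - x) * (g0 - g1) > 0" using that(1,2) by (simp add: algebra_simps)
    then have "g0 > g1" using \<open>x < y\<close> by (simp add: zero_less_mult_iff)
    then have "(1 - y) * g0 > 0" "y * g1 \<ge> 0" using \<open>\<not> g1 < 0\<close> that by auto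
    then show False using that(2) by linarith
  qed
  note c = cyc4_all[OF q]
  let ?f = "turn (p a) (p b)" and ?g = "turn (p c) (p d)"
  have g: "(1 - x) * ?g (p u) + x * ?g (p v) > 0" "(1 - y) * ?g (p u) + y * ?g (p v) = 0"
    using between[OF x, of c d] between[OF y, of a b] c lt
    unfolding linepath_def turn_affine by auto
  \<comment> \<open>The same for the reversed line, with the parameters \<open>1 - y < 1 - x\<close>.\<close>
  have f: "(1 - (1 - y)) * ?f (p v) + (1 - y) * ?f (p u) > 0"
    "(1 - (1 - x)) * ?f (p v) + (1 - x) * ?f (p u) = 0"
    using between[OF x, of c d] between[OF y, of a b] c lt
    unfolding linepath_def turn_affine by (auto simp: add.commute)
  have "?g (p v) < 0" using drop[OF g] xy by simp
  moreover have "?f (p u) < 0" using drop[OF f] xy by simp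
  ultimately show ?thesis using turn_neg_iff lt by simp
qed

end

section \<open>Edges and colours of the polygon\<close>

lemma side_verts: "side (verts n) k = {k mod (2 * n + 2), Suc k mod (2 * n + 2)}"
proof -
  have "k mod (2 * n + 2) < 2 * n + 2" "Suc k mod (2 * n + 2) < 2 * n + 2" by simp_all
  then show ?thesis unfolding side_def verts_def by (simp del: upt_Suc)
qed

lemma boundary_edge_iff:
  "e \<in> boundary_edges n \<longleftrightarrow> (\<exists>k<2 * n + 2. e = {k, Suc k mod (2 * n + 2)})"
proof
  assume "e \<in> boundary_edges n"
  then obtain k where "e = {k mod (2 * n + 2), Suc k mod (2 * n + 2)}"
    unfolding boundary_edges_def side_verts by blast
  then show "\<exists>k<2 * n + 2. e = {k, Suc k mod (2 * n + 2)}"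
    by (intro exI[of _ "k mod (2 * n + 2)"]) (simp add: mod_Suc_eq)
next
  assume "\<exists>k<2 * n + 2. e = {k, Suc k mod (2 * n + 2)}"
  then obtain k where "k < 2 * n + 2" "e = {k, Suc k mod (2 * n + 2)}" by blast
  then have "e = side (verts n) k" by (simp add: side_verts)
  then show "e \<in> boundary_edges n" unfolding boundary_edges_def by blast
qed

lemma boundary_edge_not_interlace:
  assumes "{a, b} \<in> boundary_edges n" "c < 2 * n + 2" "d < 2 * n + 2"
  shows "\<not> interlace a b c d"
proof
  assume i: "interlace a b c d"
  obtain k where k: "k < 2 * n + 2" "{a, b} = {k, Suc k mod (2 * n + 2)}"
    using assms boundary_edge_iff by blast
  define k' where "k' = Suc k mod (2 * n + 2)"
  have "interlace k k' c d"
    using i k interlace_commute unfolding k'_def doubleton_eq_iff by blast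
  moreover have "cyc k k' c \<or> c = k \<or> c = k'" "cyc k k' d \<or> d = k \<or> d = k'"
    using cyc_Suc[OF k(1), of c] cyc_Suc[OF k(1), of d] assms unfolding k'_def by blast+
  ultimately show False
    using interlace_cyc cyc_asym cyc_distinct by blast
qed

text \<open>
  The successors of the two end points of a diagonal lie on different sides of it.
\<close>
lemma diagonal_neighbours:
  assumes "{a, b} \<in> diagonals n"
  obtains c d where "cyc4 a c b d" "c < 2 * n + 2" "d < 2 * n + 2"
proof
  let ?c = "Suc a mod (2 * n + 2)" and ?d = "Suc b mod (2 * n + 2)"
  have ab: "a < 2 * n + 2" "b < 2 * n + 2" "a \<noteq> b"
    using assms unfolding diagonals_def verts_def by (auto simp: card_insert_if split: if_splits)
  have "{a, ?c} \<in> boundary_edges n" "{b, ?d} \<in> boundary_edges n"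
    using ab unfolding boundary_edge_iff by auto
  then have "{a, ?c} \<noteq> {a, b}" "{b, ?d} \<noteq> {b, a}"
    using assms unfolding diagonals_def by (auto simp: insert_commute)
  then have "?c \<noteq> b" "?d \<noteq> a" by auto
  then show "cyc4 a ?c b ?d"
    using ab cyc_Suc[of a _ b] cyc_Suc[of b _ a] by (intro cyc4I) auto
  show "?c < 2 * n + 2" "?d < 2 * n + 2" by simp_all
qed

lemma diagonalsD:
  assumes "{a, b} \<in> diagonals n"
  shows "a < 2 * n + 2" "b < 2 * n + 2" "a \<noteq> b" "{a, b} \<notin> boundary_edges n"
  using assms unfolding diagonals_def verts_def by (auto simp: card_insert_if split: if_splits)

lemma edgesD:
  assumes "{a, b} \<in> edges n D" "D \<subseteq> diagonals n"
  shows "a < 2 * n + 2" "b < 2 * n + 2" "a \<noteq> b"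
proof -
  have "a < 2 * n + 2 \<and> b < 2 * n + 2 \<and> a \<noteq> b"
  proof (cases "{a, b} \<in> D")
    case True
    then show ?thesis using assms diagonalsD by blast
  next
    case False
    then obtain k where k: "k < 2 * n + 2" "{a, b} = {k, Suc k mod (2 * n + 2)}"
      using assms boundary_edge_iff unfolding edges_def by blast
    moreover have "Suc k mod (2 * n + 2) < 2 * n + 2" "Suc k mod (2 * n + 2) \<noteq> k"
      using k(1) by (simp_all add: mod_Suc)
    ultimately show ?thesis by (metis doubleton_eq_iff)
  qed
  then show "a < 2 * n + 2" "b < 2 * n + 2" "a \<noteq> b" by auto
qed

lemma alternating_parity:
  assumes "alternating_colouring n wh" "k < 2 * n + 2"
  shows "wh k \<longleftrightarrow> (wh 0 \<longleftrightarrow> even k)"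
  using assms(2)
proof (induction k)
  case (Suc k)
  then have "k \<in> verts n" by (simp add: verts_def)
  then have "wh (Suc k mod (2 * n + 2)) \<longleftrightarrow> \<not> wh k"
    using assms(1) unfolding alternating_colouring_def by blast
  moreover have "Suc k mod (2 * n + 2) = Suc k" using Suc.prems by (rule mod_less)
  moreover have "wh k \<longleftrightarrow> (wh 0 \<longleftrightarrow> even k)" using Suc by simp
  ultimately show ?case by simp
qed simp

lemma white_end_eq: "wh a \<Longrightarrow> \<not> wh b \<Longrightarrow> white_end wh {a, b} = a"
  unfolding white_end_def by (rule the_equality) auto

lemma black_end_eq: "wh a \<Longrightarrow> \<not> wh b \<Longrightarrow> black_end wh {a, b} = b"
  unfolding black_end_def by (rule the_equality) auto

section \<open>Cells of a quadrangulation\<close>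

lemma component_contains_limit:
  assumes "C \<in> components U" "z \<in> U" "z \<in> closure C"
  shows "z \<in> C"
proof -
  obtain T where T: "closed T" "C = U \<inter> T"
    using closedin_component[OF assms(1)] closedin_closed by blast
  then have "closure C \<subseteq> T" by (simp add: closure_minimal)
  then show ?thesis using assms T by blast
qed

locale polygon = clockwise p "2 * n + 2" for p n
begin

lemma open_diagonal_inside:
  assumes q: "cyc4 a b c d" "a < 2 * n + 2" "b < 2 * n + 2" "c < 2 * n + 2" "d < 2 * n + 2"
  shows "open_segment (p a) (p c) \<subseteq> interior (convex hull (p ` {a, b, c, d}))"
proof
  fix z assume "z \<in> open_segment (p a) (p c)"
  then obtain s where s: "0 < s" "s < 1" "z = (1 - s) *\<^sub>R p a + s *\<^sub>R p c"
    by (auto simp: in_segment)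
  have "turn (p a) (p b) (p c) > 0" "turn (p b) (p c) (p a) > 0" "turn (p c) (p d) (p a) > 0"
    "turn (p d) (p a) (p c) > 0"
    using cyc4_all[OF q(1)] q by (simp_all add: turn_pos_iff)
  then show "z \<in> interior (convex hull (p ` {a, b, c, d}))"
    unfolding quadrilateral_interior[OF q] using s by (simp add: turn_affine)
qed

lemma quadrilateral_inside:
  assumes "S \<subseteq> verts n"
  shows "interior (convex hull (p ` S)) \<subseteq> interior (convex hull (p ` verts n))"
  using assms by (intro interior_mono hull_mono image_mono)

text \<open>
  A diagonal runs inside the quadrilateral spanned by it and a vertex on either side.
\<close>
lemma diagonal_inside:
  assumes "{a, b} \<in> diagonals n"
  shows "open_segment (p a) (p b) \<subseteq> interior (convex hull (p ` verts n))"
proof -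
  obtain c d where q: "cyc4 a c b d" "c < 2 * n + 2" "d < 2 * n + 2"
    using diagonal_neighbours[OF assms] .
  note ab = diagonalsD[OF assms]
  have "{a, c, b, d} \<subseteq> verts n" using q ab by (auto simp: verts_def)
  then show ?thesis
    using open_diagonal_inside[OF q(1) ab(1) q(2) ab(2) q(3)] quadrilateral_inside by blast
qed

lemma squareE:
  assumes "S \<in> squares p n D" "a \<in> S"
  obtains b c d where "S = {a, b, c, d}" "cyc4 a b c d"
    "a < 2 * n + 2" "b < 2 * n + 2" "c < 2 * n + 2" "d < 2 * n + 2"
proof -
  have S: "S \<subseteq> verts n" "card S = 4" using assms unfolding squares_def by auto
  then have "card (S - {a}) = 3" using assms by (simp add: card_Diff_singleton_if)
  then obtain x y z where xyz: "S - {a} = {x, y, z}" "x \<noteq> y" "y \<noteq> z" "x \<noteq> z"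
    by (auto simp: card_Suc_eq numeral_3_eq_3)
  then have S': "S = {a, x, y, z}" "a \<noteq> x" "a \<noteq> y" "a \<noteq> z" using assms(2) by auto
  have "cyc4 a x y z \<or> cyc4 a x z y \<or> cyc4 a y x z \<or> cyc4 a y z x \<or> cyc4 a z x y \<or> cyc4 a z y x"
    using cyc_total[of a x y] cyc_total[of a y z] cyc_total[of a x z] xyz(2-4) S'(2-4)
    unfolding cyc4_def by blast
  moreover have "S = {a, x, z, y}" "S = {a, y, x, z}" "S = {a, y, z, x}" "S = {a, z, x, y}" "S = {a, z, y, x}"
    using S' by auto
  moreover have "a < 2 * n + 2" "x < 2 * n + 2" "y < 2 * n + 2" "z < 2 * n + 2"
    using S S' by (auto simp: verts_def)
  ultimately show ?thesis using that S'(1) by metis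
qed

lemma vertex_in_quadrilateral:
  assumes "cyc4 a b c d" "a < 2 * n + 2" "b < 2 * n + 2" "c < 2 * n + 2" "d < 2 * n + 2" "v < 2 * n + 2"
    and "p v \<in> convex hull (p ` {a, b, c, d})"
  shows "v \<in> {a, b, c, d}"
proof (rule ccontr)
  assume "v \<notin> {a, b, c, d}"
  then have "cyc a v b \<or> cyc b v c \<or> cyc c v d \<or> cyc d v a" using cyc4_arcs assms(1) by blast
  then have "turn (p a) (p b) (p v) < 0 \<or> turn (p b) (p c) (p v) < 0 \<or> turn (p c) (p d) (p v) < 0 \<or>
    turn (p d) (p a) (p v) < 0"
    using assms(2-6) turn_cyc_neg by blast
  then show False using assms(7) unfolding quadrilateral_hull[OF assms(1-5)] by auto
qed

end

locale quadrangulated_polygon = polygon +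
  fixes D
  assumes quadrangulation: "quadrangulation p n D"
begin

lemma diagonals: "D \<subseteq> diagonals n"
  using quadrangulation unfolding quadrangulation_def by blast

lemma finite_diagonals: "finite D"
proof (rule finite_subset)
  show "D \<subseteq> Pow (verts n)" using diagonals unfolding diagonals_def by auto
qed (simp add: verts_def)

lemmas edgesD = edgesD[OF _ diagonals]

text \<open>
  Noncrossing of edges in the purely cyclic form in which it is used from here on.
\<close>
lemma edges_not_interlace:
  assumes "{a, b} \<in> edges n D" "{c, d} \<in> edges n D"
  shows "\<not> interlace a b c d"
proof (cases "{a, b} \<in> boundary_edges n \<or> {c, d} \<in> boundary_edges n")
  case True
  then show ?thesis
    using boundary_edge_not_interlace[of a b n c d] boundary_edge_not_interlace[of c d n a b]
      edgesD[OF assms(1)] edgesD[OF assms(2)] interlace_commute(1)[of a b c d] by auto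
next
  case False
  then have D: "{a, b} \<in> D" "{c, d} \<in> D" using assms unfolding edges_def by auto
  show ?thesis
  proof
    assume i: "interlace a b c d"
    have ne: "{a, b} \<noteq> {c, d}"
      using interlace_cyc[OF i] cyc_distinct unfolding doubleton_eq_iff by blast
    have "pairwise (\<lambda>e f. \<not> crosses p e p f) D"
      using quadrangulation unfolding quadrangulation_def by simp
    from pairwiseD[OF this D ne] have "\<not> crosses p {a, b} p {c, d}" .
    then show False
      using crosses_if_interlace[OF _ _ _ _ i] edgesD[OF assms(1)] edgesD[OF assms(2)]
      unfolding crosses_def by (simp add: open_edge_segment)
  qed
qed

lemma square_cell:
  assumes "S \<in> squares p n D"
  shows "interior (convex hull (p ` S)) \<in>
    components (interior (convex hull (p ` verts n)) - (\<Union>e\<in>D. convex hull (p ` e)))"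
  using assms unfolding squares_def cells_def by blast

lemma square_disjoint_edge:
  assumes "S \<in> squares p n D" "{u, v} \<in> D" "z \<in> closed_segment (p u) (p v)"
  shows "z \<notin> interior (convex hull (p ` S))"
proof -
  have "z \<in> convex hull (p ` {u, v})" using assms(3) by (simp add: segment_convex_hull)
  then show ?thesis using in_components_subset[OF square_cell[OF assms(1)]] assms(2) by blast
qed

text \<open>
  If a diagonal of the quadrangulation crossed the side, it would enter the cell.  If the side is
  not an edge, its midpoint is therefore off all edges and inside the polygon, so it belongs to an open
  cell; being a limit of points of the square, it belongs to the square's cell, which is absurd for a
  boundary point.
\<close>
lemma side_of_square_is_edge:
  assumes S: "{a, b, c, d} \<in> squares p n D" and q: "cyc4 a b c d"
  shows "{a, b} \<in> edges n D"
proof (rule ccontr)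
  assume no: "{a, b} \<notin> edges n D"
  have lt: "a < 2 * n + 2" "b < 2 * n + 2" "c < 2 * n + 2" "d < 2 * n + 2"
    using S unfolding squares_def verts_def by auto
  note q' = cyc4_all[OF q]
  have ab: "a \<noteq> b" using q' cyc_distinct by blast
  then have dia: "{a, b} \<in> diagonals n"
    using no lt unfolding edges_def diagonals_def verts_def by auto
  define z where "z = midpoint (p a) (p b)"
  have z: "z \<in> open_segment (p a) (p b)"
    using vertex_inj ab lt unfolding z_def by (auto simp: midpoint_in_open_segment)
  \<comment> \<open>A diagonal through the midpoint crosses the side, and its half on the inner side enters the cell.\<close>
  have avoid: "z \<notin> convex hull (p ` g)" if g: "g \<in> D" for g
  proof
    assume zg: "z \<in> convex hull (p ` g)"
    obtain u v where uv: "g = {u, v}"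
      using g diagonals unfolding diagonals_def by (auto simp: card_2_iff)
    note lt' = diagonalsD[of u v n]
    have uvlt: "u < 2 * n + 2" "v < 2 * n + 2" "u \<noteq> v"
      using lt' g uv diagonals by auto
    have zuv: "z \<in> closed_segment (p u) (p v)" using zg uv by (simp add: segment_convex_hull)
    have "{a, b} \<noteq> {u, v}" using no g uv unfolding edges_def by auto
    then have "interlace a b u v"
      using interlace_if_meet z zuv lt uvlt ab by blast
    then obtain y where y: "cyc a b y" "y = u \<or> y = v"
      using interlace_cyc by blast
    then have "0 < turn (p a) (p b) (p y)" using turn_cyc lt uvlt by blast
    then have "\<forall>\<^sub>F \<delta> in at_right 0. (1 - \<delta>) *\<^sub>R z + \<delta> *\<^sub>R p y \<in> interior (convex hull (p ` {a, b, c, d}))"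
      using eventually_inside q lt z by blast
    moreover have "\<forall>\<^sub>F \<delta> in at_right (0::real). 0 < \<delta> \<and> \<delta> < 1"
      by (rule eventually_at_rightI[of 0 1]) auto
    ultimately have "\<forall>\<^sub>F \<delta> in at_right (0::real). False"
    proof eventually_elim
      case (elim \<delta>)
      have "(1 - \<delta>) *\<^sub>R z + \<delta> *\<^sub>R p y \<in> closed_segment z (p y)"
        unfolding in_segment(1) using elim by (intro exI[of _ \<delta>]) simp
      moreover have "closed_segment z (p y) \<subseteq> closed_segment (p u) (p v)"
        unfolding subset_closed_segment using y(2) zuv by auto
      ultimately show ?case using square_disjoint_edge[OF S] g uv elim by blast
    qed
    then show False by simp
  qed
  have zU: "z \<in> interior (convex hull (p ` verts n)) - (\<Union>e\<in>D. convex hull (p ` e))"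
    using diagonal_inside[OF dia] z avoid by blast
  let ?C = "interior (convex hull (p ` {a, b, c, d}))"
  have "0 < turn (p a) (p b) (p c)" using turn_cyc q' lt by blast
  then have ev: "\<forall>\<^sub>F \<delta> in at_right 0. (1 - \<delta>) *\<^sub>R z + \<delta> *\<^sub>R p c \<in> ?C"
    using eventually_inside q lt z by blast
  have "((\<lambda>\<delta>. (1 - \<delta>) *\<^sub>R z + \<delta> *\<^sub>R p c) \<longlongrightarrow> (1 - 0) *\<^sub>R z + 0 *\<^sub>R p c) (at_right 0)"
    by (intro tendsto_intros)
  then have "((\<lambda>\<delta>. (1 - \<delta>) *\<^sub>R z + \<delta> *\<^sub>R p c) \<longlongrightarrow> z) (at_right 0)" by simp
  then have "z \<in> closure ?C"
    using ev by (intro Lim_in_closed_set[OF closed_closure])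
      (auto elim!: eventually_mono intro: closure_subset[THEN subsetD])
  then have "z \<in> ?C" by (rule component_contains_limit[OF square_cell[OF S] zU])
  then have "0 < turn (p a) (p b) z" using quadrilateral_interior[OF q lt] by blast
  moreover have "turn (p a) (p b) z = 0" using z by (auto simp: in_segment turn_affine)
  ultimately show False by simp
qed

lemma square_lt:
  assumes "{a, b, c, d} \<in> squares p n D"
  shows "a < 2 * n + 2" "b < 2 * n + 2" "c < 2 * n + 2" "d < 2 * n + 2"
  using assms unfolding squares_def verts_def by auto

lemma square_cyclic:
  assumes "S \<in> squares p n D"
  obtains a b c d where "S = {a, b, c, d}" "cyc4 a b c d"
proof -
  have "S \<noteq> {}" using assms unfolding squares_def by auto
  then obtain a where "a \<in> S" by blast
  from squareE[OF assms this] that show ?thesis by metis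
qed

lemma square_rotate: "{a, b, c, d} \<in> squares p n D \<Longrightarrow> {b, c, d, a} \<in> squares p n D"
  by (simp add: insert_commute)

lemma sides_of_square_are_edges:
  assumes "{a, b, c, d} \<in> squares p n D" "cyc4 a b c d"
  shows "{a, b} \<in> edges n D" "{b, c} \<in> edges n D" "{c, d} \<in> edges n D" "{d, a} \<in> edges n D"
proof -
  note s2 = square_rotate[OF assms(1)] and c2 = cyc4_rotate[OF assms(2)]
  note s3 = square_rotate[OF s2] and c3 = cyc4_rotate[OF c2]
  show "{a, b} \<in> edges n D" "{b, c} \<in> edges n D" "{c, d} \<in> edges n D" "{d, a} \<in> edges n D"
    using assms s2 c2 s3 c3 square_rotate[OF s3] cyc4_rotate[OF c3] side_of_square_is_edge
    by blast+
qed

text \<open>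
  Points close to the midpoint of the diagonal, on its right, avoid all edges and lie in a single cell.
  The midpoint is in the closure of that cell but not in the cell, hence on the line of one of its sides.
  That side is an edge, which the diagonal cannot cross, so it is the diagonal itself.
\<close>
lemma square_at_edge:
  assumes e: "{a, b} \<in> D"
  obtains c d where "cyc4 a b c d" "{a, b, c, d} \<in> squares p n D"
proof -
  have dia: "{a, b} \<in> diagonals n" using e diagonals by blast
  note ab = diagonalsD[OF dia]
  define z where "z = midpoint (p a) (p b)"
  have z: "z \<in> open_segment (p a) (p b)"
    using vertex_inj ab unfolding z_def by (auto simp: midpoint_in_open_segment)
  have zab: "turn (p a) (p b) z = 0" using z by (auto simp: in_segment turn_affine)
  obtain y0 x0 where "cyc4 a x0 b y0" "x0 < 2 * n + 2" "y0 < 2 * n + 2"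
    using diagonal_neighbours[OF dia] .
  then have y0: "0 < turn (p a) (p b) (p y0)" using turn_cyc cyc4_all(7) ab by blast
  \<comment> \<open>A path that starts at the midpoint and leaves the diagonal to its right.\<close>
  define q where "q \<delta> = (1 - \<delta>) *\<^sub>R z + \<delta> *\<^sub>R p y0" for \<delta> :: real
  have q_pos: "0 < turn (p a) (p b) (q \<delta>)" if "0 < \<delta>" for \<delta>
    using that y0 zab unfolding q_def by (simp add: turn_affine)
  have q_lim: "(q \<longlongrightarrow> z) (at_right 0)"
  proof -
    have "(q \<longlongrightarrow> (1 - 0) *\<^sub>R z + 0 *\<^sub>R p y0) (at_right 0)"
      unfolding q_def by (intro tendsto_intros)
    then show ?thesis by simp
  qed
  have avoid: "z \<notin> convex hull (p ` g)" if g: "g \<in> D - {{a, b}}" for g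
  proof
    assume zg: "z \<in> convex hull (p ` g)"
    obtain u v where uv: "g = {u, v}"
      using g diagonals unfolding diagonals_def card_2_iff by blast
    have uvD: "{u, v} \<in> edges n D" using g uv unfolding edges_def by auto
    have zuv: "z \<in> closed_segment (p u) (p v)" using zg uv by (simp add: segment_convex_hull)
    have "{a, b} \<noteq> {u, v}" using g uv by auto
    then have "interlace a b u v"
      using interlace_if_meet z zuv ab edgesD[OF uvD] by blast
    then show False using edges_not_interlace uvD e unfolding edges_def by blast
  qed
  let ?V = "interior (convex hull (p ` verts n)) - (\<Union>g\<in>D - {{a, b}}. convex hull (p ` g))"
  let ?U = "interior (convex hull (p ` verts n)) - (\<Union>g\<in>D. convex hull (p ` g))"
  have closed_hull: "closed (convex hull (p ` g))" if "g \<in> D" for g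
  proof -
    have "finite g" using that diagonals unfolding diagonals_def verts_def
      by (auto intro: finite_subset)
    then show ?thesis by (simp add: finite_imp_compact_convex_hull compact_imp_closed)
  qed
  have "open ?V"
    using finite_diagonals closed_hull by (intro open_Diff open_interior closed_UN) auto
  moreover have zP: "z \<in> interior (convex hull (p ` verts n))"
    using diagonal_inside[OF dia] z by blast
  moreover have "z \<in> ?V" using zP avoid by blast
  ultimately have "\<forall>\<^sub>F \<delta> in at_right 0. q \<delta> \<in> ?V"
    using q_lim by (intro topological_tendstoD) auto
  then obtain \<epsilon> where \<epsilon>: "0 < \<epsilon>" "\<And>\<delta>. 0 < \<delta> \<Longrightarrow> \<delta> < \<epsilon> \<Longrightarrow> q \<delta> \<in> ?V"
    unfolding eventually_at_right_field by auto
  have qU: "q \<delta> \<in> ?U" if "0 < \<delta>" "\<delta> < \<epsilon>" for \<delta>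
  proof -
    have "q \<delta> \<notin> convex hull (p ` {a, b})"
    proof
      assume "q \<delta> \<in> convex hull (p ` {a, b})"
      then have "q \<delta> \<in> closed_segment (p a) (p b)" by (simp add: segment_convex_hull)
      then have "turn (p a) (p b) (q \<delta>) = 0" by (auto simp: in_segment turn_affine)
      then show False using q_pos[OF that(1)] by simp
    qed
    then show ?thesis using \<epsilon>(2)[OF that] by blast
  qed
  have "connected (q ` {0<..<\<epsilon>})"
    unfolding q_def by (intro connected_continuous_image continuous_intros) simp
  moreover have "q ` {0<..<\<epsilon>} \<subseteq> ?U" using qU by auto
  moreover have "?U \<noteq> {}" using qU[of "\<epsilon> / 2"] \<epsilon>(1) by auto
  ultimately obtain C where C: "C \<in> components ?U" "q ` {0<..<\<epsilon>} \<subseteq> C"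
    using exists_component_superset[of "q ` {0<..<\<epsilon>}" ?U] by blast
  have "C \<in> cells p n D" using C(1) unfolding cells_def .
  then obtain S where S: "S \<in> squares p n D" "C = interior (convex hull (p ` S))"
    using quadrangulation unfolding quadrangulation_def by blast
  have ev: "\<forall>\<^sub>F \<delta> in at_right 0. q \<delta> \<in> C"
    using C(2) \<epsilon>(1) unfolding eventually_at_right_field by (intro exI[of _ \<epsilon>]) auto
  then have "z \<in> closure C"
    using q_lim by (intro Lim_in_closed_set[OF closed_closure])
      (auto elim!: eventually_mono intro: closure_subset[THEN subsetD])
  moreover have "closure C \<subseteq> convex hull (p ` S)"
  proof -
    have "finite S" using S(1) unfolding squares_def by (auto intro: card_ge_0_finite)
    then show ?thesis unfolding S(2)
      by (intro closure_minimal interior_subset compact_imp_closed finite_imp_compact_convex_hull) simp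
  qed
  ultimately have zS: "z \<in> convex hull (p ` S)" by blast
  have "z \<in> closed_segment (p a) (p b)" using z by (simp add: open_closed_segment)
  then have zC: "z \<notin> C" using square_disjoint_edge S e by blast
  obtain s1 s2 s3 s4 where s: "S = {s1, s2, s3, s4}" "cyc4 s1 s2 s3 s4"
    using square_cyclic[OF S(1)] .
  note sq = S(1)[unfolded s(1)]
  note lt = square_lt[OF sq]
  \<comment> \<open>The point is in the closed square but not in its interior, so it is on the line of a side.\<close>
  obtain a' b' c' d' where q': "S = {a', b', c', d'}" "cyc4 a' b' c' d'" "turn (p a') (p b') z = 0"
  proof -
    have rot: "S = {s2, s3, s4, s1}" "S = {s3, s4, s1, s2}" "S = {s4, s1, s2, s3}" using s(1) by auto
    have "cyc4 s2 s3 s4 s1" "cyc4 s3 s4 s1 s2" "cyc4 s4 s1 s2 s3"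
      using s(2) cyc4_rotate by blast+
    moreover have "turn (p s1) (p s2) z = 0 \<or> turn (p s2) (p s3) z = 0 \<or> turn (p s3) (p s4) z = 0 \<or>
      turn (p s4) (p s1) z = 0"
      using zS[unfolded s(1) quadrilateral_hull[OF s(2) lt]]
        zC[unfolded S(2) s(1) quadrilateral_interior[OF s(2) lt]] by auto
    ultimately show ?thesis using that s rot by metis
  qed
  note sq' = S(1)[unfolded q'(1)]
  note lt' = square_lt[OF sq']
  have e': "{a', b'} \<in> edges n D" using side_of_square_is_edge sq' q'(2) by blast
  have ab': "a' \<noteq> b'" using edgesD(3)[OF e'] .
  \<comment> \<open>The side's line meets the diagonal between its ends; as the two edges do not cross, both ends are on that line.\<close>
  have eq: "{a, b} = {a', b'}"
  proof (rule ccontr)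
    assume ne: "{a, b} \<noteq> {a', b'}"
    have "\<not> interlace a' b' a b" using edges_not_interlace e e' unfolding edges_def by blast
    then have ni: "\<not> (cyc a' a b' \<and> cyc a' b' b)" "\<not> (cyc a' b b' \<and> cyc a' b' a)"
      unfolding interlace_def cyc4_def by blast+
    obtain t where t: "0 < t" "t < 1" "z = (1 - t) *\<^sub>R p a + t *\<^sub>R p b"
      using z by (auto simp: in_segment)
    let ?u = "turn (p a') (p b') (p a)" and ?v = "turn (p a') (p b') (p b)"
    have sum: "(1 - t) * ?u + t * ?v = 0" using q'(3) t(3) by (simp add: turn_affine)
    have "\<not> (?u < 0 \<and> ?v > 0)" "\<not> (?v < 0 \<and> ?u > 0)"
      using ni turn_pos_iff turn_neg_iff lt' ab by auto
    then have "?u \<ge> 0 \<and> ?v \<ge> 0 \<or> ?u \<le> 0 \<and> ?v \<le> 0" by linarith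
    then have "(1 - t) * ?u = 0 \<and> t * ?v = 0"
    proof
      assume "?u \<ge> 0 \<and> ?v \<ge> 0"
      then have "0 \<le> (1 - t) * ?u" "0 \<le> t * ?v" using t by auto
      then show ?thesis using sum by linarith
    next
      assume "?u \<le> 0 \<and> ?v \<le> 0"
      then have "(1 - t) * ?u \<le> 0" "t * ?v \<le> 0" using t by (auto simp: mult_le_0_iff)
      then show ?thesis using sum by linarith
    qed
    then have "?u = 0" "?v = 0" using t by auto
    then have "a \<in> {a', b'}" "b \<in> {a', b'}" using turn_zero_iff lt' ab ab' by auto
    then show False using ne ab by auto
  qed
  \<comment> \<open>With the opposite orientation the square would be on the left of the diagonal.\<close>
  have "\<not> (a' = b \<and> b' = a)"
  proof
    assume *: "a' = b \<and> b' = a"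
    have "q (\<epsilon> / 2) \<in> C" using C(2) \<epsilon>(1) by auto
    then have "0 < turn (p b) (p a) (q (\<epsilon> / 2))"
      using * unfolding S(2) q'(1) quadrilateral_interior[OF q'(2) lt'] by auto
    then show False using q_pos[of "\<epsilon> / 2"] \<epsilon>(1) by (simp add: turn_swap[of "p b"])
  qed
  then have "a' = a" "b' = b" using eq by (auto simp: doubleton_eq_iff)
  then show ?thesis using that q'(2) sq' by blast
qed

text \<open>
  Two squares on the same side of an edge overlap near its midpoint, hence are the same cell, and the
  corners of a square can be recovered from its closed cell.
\<close>
lemma square_at_edge_unique:
  assumes S: "{a, b, c, d} \<in> squares p n D" "cyc4 a b c d"
    and S': "{a, b, c', d'} \<in> squares p n D" "cyc4 a b c' d'"
  shows "c = c' \<and> d = d'"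
proof -
  note lt = square_lt[OF S(1)] and lt' = square_lt[OF S'(1)]
  note q = cyc4_all[OF S(2)] and q' = cyc4_all[OF S'(2)]
  let ?I = "interior (convex hull (p ` {a, b, c, d}))"
  let ?I' = "interior (convex hull (p ` {a, b, c', d'}))"
  define z where "z = midpoint (p a) (p b)"
  have "p a \<noteq> p b" using vertex_inj[of a b] lt q cyc_distinct by blast
  then have z: "z \<in> open_segment (p a) (p b)"
    unfolding z_def by (auto simp: midpoint_in_open_segment)
  have "0 < turn (p a) (p b) (p c)" using turn_cyc q lt by blast
  then have "\<forall>\<^sub>F \<delta> in at_right 0. (1 - \<delta>) *\<^sub>R z + \<delta> *\<^sub>R p c \<in> ?I \<and> (1 - \<delta>) *\<^sub>R z + \<delta> *\<^sub>R p c \<in> ?I'"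
    using eventually_inside[OF S(2) lt z] eventually_inside[OF S'(2) lt' z] by (simp add: eventually_conj)
  then obtain \<delta> where "(1 - \<delta>) *\<^sub>R z + \<delta> *\<^sub>R p c \<in> ?I \<inter> ?I'"
    using eventually_happens'[OF trivial_limit_at_right_real] by blast
  then have ne: "?I \<inter> ?I' \<noteq> {}" by blast
  then have eq: "?I = ?I'"
    using components_nonoverlap[OF square_cell[OF S(1)] square_cell[OF S'(1)]] by blast
  have cl: "closure (interior (convex hull (p ` {a, b, x, y}))) = convex hull (p ` {a, b, x, y})"
    if "interior (convex hull (p ` {a, b, x, y})) \<noteq> {}" for x y
    using convex_closure_interior[OF convex_convex_hull that]
    by (simp add: closure_closed compact_imp_closed finite_imp_compact_convex_hull)
  have hulls: "convex hull (p ` {a, b, c, d}) = convex hull (p ` {a, b, c', d'})"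
  proof -
    have "?I \<noteq> {}" "?I' \<noteq> {}" using ne by blast+
    then show ?thesis using cl[of c d] cl[of c' d'] unfolding eq by metis
  qed
  have "p c \<in> convex hull (p ` {a, b, c, d})" "p d \<in> convex hull (p ` {a, b, c, d})"
    by (auto intro!: hull_inc)
  then have "c \<in> {a, b, c', d'}" "d \<in> {a, b, c', d'}"
    using vertex_in_quadrilateral[OF S'(2) lt'] lt unfolding hulls by blast+
  then have "c \<in> {c', d'}" "d \<in> {c', d'}" using q[THEN cyc_distinct] by blast+
  then show ?thesis using q(7) q'(7) cyc_asym[of a c d] cyc_distinct[of a c d] by blast
qed

lemma square_diagonal_not_edge:
  assumes S: "{a, b, c, d} \<in> squares p n D" "cyc4 a b c d"
  shows "{a, c} \<notin> D"
proof
  assume "{a, c} \<in> D"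
  note lt = square_lt[OF S(1)]
  have "p a \<noteq> p c" using vertex_inj[of a c] lt cyc4_all[OF S(2)] cyc_distinct by blast
  then have z: "midpoint (p a) (p c) \<in> open_segment (p a) (p c)"
    by (auto simp: midpoint_in_open_segment)
  then have "midpoint (p a) (p c) \<in> interior (convex hull (p ` {a, b, c, d}))"
    using open_diagonal_inside[OF S(2) lt] by blast
  then show False
    using square_disjoint_edge[OF S(1) \<open>{a, c} \<in> D\<close>] z open_closed_segment by blast
qed

text \<open>
  The midpoint of such a diagonal lies in a cell.  An end point that is not a corner of this square would
  be cut off by a side of the square, and the diagonal would have to cross that side.
\<close>
lemma noncrossing_diagonal_in_square:
  assumes j: "{u, v} \<in> diagonals n" "{u, v} \<notin> D"
    and nc: "\<And>x y. {x, y} \<in> D \<Longrightarrow> \<not> interlace x y u v"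
  obtains b d where "{u, b, v, d} \<in> squares p n D" "cyc4 u b v d"
proof -
  note uv = diagonalsD[OF j(1)]
  define z where "z = midpoint (p u) (p v)"
  have z: "z \<in> open_segment (p u) (p v)"
    using vertex_inj uv unfolding z_def by (auto simp: midpoint_in_open_segment)
  have "z \<notin> convex hull (p ` g)" if g: "g \<in> D" for g
  proof
    assume zg: "z \<in> convex hull (p ` g)"
    obtain x y where xy: "g = {x, y}"
      using g diagonals unfolding diagonals_def card_2_iff by blast
    have xyD: "{x, y} \<in> edges n D" using g xy unfolding edges_def by auto
    have "z \<in> closed_segment (p x) (p y)" using zg xy by (simp add: segment_convex_hull)
    moreover have "{u, v} \<noteq> {x, y}" using g xy j by auto
    ultimately have "interlace u v x y"
      using interlace_if_meet z uv edgesD[OF xyD] by blast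
    then show False using nc g xy interlace_commute(1) by blast
  qed
  then have "z \<in> interior (convex hull (p ` verts n)) - (\<Union>g\<in>D. convex hull (p ` g))"
    using diagonal_inside[OF j(1)] z by blast
  then obtain C where C: "C \<in> components (interior (convex hull (p ` verts n)) - (\<Union>g\<in>D. convex hull (p ` g)))"
    "z \<in> C"
    by (metis Union_components UnionE)
  then have "C \<in> cells p n D" unfolding cells_def by blast
  then obtain S where S: "S \<in> squares p n D" "C = interior (convex hull (p ` S))"
    using quadrangulation unfolding quadrangulation_def by blast
  have zS: "0 < turn (p a) (p b) z" if "S = {a, b, c, d}" "cyc4 a b c d" for a b c d
  proof -
    have sq: "{a, b, c, d} \<in> squares p n D" using S that by simp
    show ?thesis
      using C(2) unfolding S(2) that(1) quadrilateral_interior[OF that(2) square_lt[OF sq]] by blast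
  qed
  obtain t where t: "0 < t" "t < 1" "z = (1 - t) *\<^sub>R p u + t *\<^sub>R p v"
    using z by (auto simp: in_segment)
  \<comment> \<open>No side of the square cuts off an end point, since the midpoint is on its inner side.\<close>
  have sep: "\<not> cyc a u b \<and> \<not> cyc a v b" if Sab: "S = {a, b, c, d}" "cyc4 a b c d" for a b c d
  proof -
    have sq: "{a, b, c, d} \<in> squares p n D" using S Sab by simp
    note lt = square_lt[OF sq]
    have e: "{a, b} \<in> edges n D" using side_of_square_is_edge sq Sab by blast
    have ni: "\<not> interlace a b u v"
      using boundary_edge_not_interlace[of a b n u v] nc e uv unfolding edges_def by blast
    have pos: "0 < (1 - t) * turn (p a) (p b) (p u) + t * turn (p a) (p b) (p v)"
      using zS[OF Sab] t(3) by (simp add: turn_affine)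
    have False if "cyc a u b"
    proof -
      have "turn (p a) (p b) (p u) < 0" using turn_cyc_neg that lt uv by blast
      then have "(1 - t) * turn (p a) (p b) (p u) < 0" using t by (simp add: mult_less_0_iff)
      then have "0 < t * turn (p a) (p b) (p v)" using pos by linarith
      then have "cyc a b v" using t turn_pos_iff lt uv by (simp add: zero_less_mult_iff)
      then show False using ni that unfolding interlace_def cyc4_def by blast
    qed
    moreover have False if "cyc a v b"
    proof -
      have "turn (p a) (p b) (p v) < 0" using turn_cyc_neg that lt uv by blast
      then have "t * turn (p a) (p b) (p v) < 0" using t by (simp add: mult_less_0_iff)
      then have "0 < (1 - t) * turn (p a) (p b) (p u)" using pos by linarith
      then have "cyc a b u" using t turn_pos_iff lt uv by (simp add: zero_less_mult_iff)
      then show False using ni that unfolding interlace_def cyc4_def by blast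
    qed
    ultimately show ?thesis by blast
  qed
  have vert: "u \<in> S \<and> v \<in> S"
  proof -
    obtain a b c d where s: "S = {a, b, c, d}" "cyc4 a b c d"
      using square_cyclic[OF S(1)] .
    have rot: "S = {b, c, d, a}" "S = {c, d, a, b}" "S = {d, a, b, c}" using s(1) by auto
    have "cyc4 b c d a" "cyc4 c d a b" "cyc4 d a b c"
      using s(2) cyc4_rotate by blast+
    then show ?thesis
      using sep[OF s] sep[OF rot(1)] sep[OF rot(2)] sep[OF rot(3)] cyc4_arcs[OF s(2)] s(1) by blast
  qed
  have "u \<in> S" using vert by blast
  from squareE[OF S(1) this] obtain b c d where s: "S = {u, b, c, d}" "cyc4 u b c d" by metis
  have s4: "S = {d, u, b, c}" "cyc4 d u b c" using s cyc4_rotate by auto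
  have "v \<noteq> b" using zS[OF s] t(3) by (auto simp: turn_affine)
  moreover have "v \<noteq> d" using zS[OF s4] t(3) by (auto simp: turn_affine)
  ultimately have "v = c" using vert s(1) uv by auto
  then show ?thesis using that s S(1) by metis
qed

section \<open>Colours of edges and exchange of a diagonal\<close>

text \<open>
  The square on the inner side of an edge from \<open>a\<close> to \<open>b\<close> has three further sides, all spanning
  shorter arcs; an odd number is the sum of three odd numbers.  The induction ends at the boundary edges.
\<close>
lemma edge_odd:
  assumes "{a, b} \<in> edges n D" "a < b"
  shows "odd (b - a)"
  using assms
proof (induction "b - a" arbitrary: a b rule: less_induct)
  case less
  show ?case
  proof (cases "{a, b} \<in> D")
    case True
    then have "{b, a} \<in> D" by (simp add: insert_commute)
    then obtain c d where s: "cyc4 b a c d" "{b, a, c, d} \<in> squares p n D" using square_at_edge by blast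
    have "cyc b a c" "cyc b c d" using s(1) unfolding cyc4_def by auto
    then have ord: "a < c" "c < d" "d < b" using \<open>a < b\<close> unfolding cyc_def by auto
    have "{a, c} \<in> edges n D" "{c, d} \<in> edges n D" "{d, b} \<in> edges n D"
      using sides_of_square_are_edges(2-4)[OF s(2,1)] .
    then have "odd (c - a)" "odd (d - c)" "odd (b - d)" using less(1) ord by auto
    moreover have "b - a = (c - a) + (d - c) + (b - d)" using ord by simp
    ultimately show ?thesis by presburger
  next
    case False
    then have "{a, b} \<in> boundary_edges n" using less(2) unfolding edges_def by blast
    then obtain k where k: "k < 2 * n + 2" "{a, b} = {k, Suc k mod (2 * n + 2)}"
      using boundary_edge_iff by blast
    show ?thesis
    proof (cases "Suc k = 2 * n + 2")
      case True
      then have "a = 0" "b = 2 * n + 1" using k \<open>a < b\<close> by (auto simp: doubleton_eq_iff)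
      then show ?thesis by simp
    next
      case False
      then have "a = k" "b = Suc k" using k \<open>a < b\<close> by (auto simp: doubleton_eq_iff)
      then show ?thesis by simp
    qed
  qed
qed

text \<open>
  Labels of different parity have different colours.  This makes the white end, the black end and the
  direction of every edge meaningful.
\<close>
lemma edge_colours:
  assumes "alternating_colouring n wh" "{a, b} \<in> edges n D"
  shows "wh a \<longleftrightarrow> \<not> wh b"
proof -
  note ab = edgesD[OF assms(2)]
  have "even a \<longleftrightarrow> odd b"
  proof (cases "a < b")
    case True
    then show ?thesis using edge_odd[OF assms(2)] by presburger
  next
    case False
    then have "b < a" using ab by simp
    then show ?thesis using edge_odd[of b a] assms(2) by (simp add: insert_commute)
  qed
  then show ?thesis using alternating_parity[OF assms(1) ab(1)] alternating_parity[OF assms(1) ab(2)] by blast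
qed

lemma square_containing_edge:
  assumes "S \<in> squares p n D" "{a, b} \<in> D" "{a, b} \<subseteq> S"
  obtains c d where "S = {a, b, c, d}" "cyc4 a b c d" | c d where "S = {b, a, c, d}" "cyc4 b a c d"
proof -
  have "a \<in> S" using assms(3) by simp
  from squareE[OF assms(1) this] obtain x y z where S: "S = {a, x, y, z}" "cyc4 a x y z" by metis
  have "b \<noteq> y" using square_diagonal_not_edge[of a x y z] S assms by blast
  moreover have "b \<noteq> a" using assms(2) diagonals diagonalsD by blast
  ultimately have "b = x \<or> b = z" using S assms(3) by auto
  then show ?thesis
  proof
    assume "b = x"
    then show ?thesis using that(1) S by blast
  next
    assume "b = z"
    then have "S = {b, a, x, y}" "cyc4 b a x y" using S cyc4_rotate by auto
    then show ?thesis using that(2) by blast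
  qed
qed

text \<open>
  An inner edge is a side, not a diagonal, of each square containing it, and has only one square on
  each side.
\<close>
lemma squares_adjacent_to_edge:
  assumes "S \<in> squares p n D" "T \<in> squares p n D" "S \<noteq> T" "{a, b} \<in> D" "{a, b} \<subseteq> S" "{a, b} \<subseteq> T"
  obtains c d e f where "cyc4 a b c d" "{a, b, c, d} \<in> squares p n D"
    "cyc4 b a e f" "{b, a, e, f} \<in> squares p n D" "S \<union> T = {a, b, c, d, e, f}"
proof -
  have *: "\<exists>c d e f. cyc4 a b c d \<and> {a, b, c, d} \<in> squares p n D \<and>
    cyc4 b a e f \<and> {b, a, e, f} \<in> squares p n D \<and> S \<union> T = {a, b, c, d, e, f}"
    if ST: "S \<in> squares p n D" "T \<in> squares p n D" "S \<noteq> T" "{a, b} \<subseteq> T"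
      "S = {a, b, c, d}" "cyc4 a b c d" for S T c d
    using ST(2) assms(4) ST(4)
  proof (cases rule: square_containing_edge)
    case (1 x y)
    then show ?thesis using square_at_edge_unique[of a b c d x y] ST by auto
  next
    case (2 x y)
    have "S \<union> T = {a, b, c, d, x, y}" using 2(1) ST(5) by auto
    then show ?thesis using 2 ST by blast
  qed
  have **: "\<exists>c d. T = {a, b, c, d} \<and> cyc4 a b c d" if "\<not> (\<exists>c d. S = {a, b, c, d} \<and> cyc4 a b c d)"
    using assms(2,4,6)
  proof (cases rule: square_containing_edge)
    case (2 x y)
    from assms(1,4,5) show ?thesis
    proof (cases rule: square_containing_edge)
      case (2 x' y')
      then show ?thesis
        using square_at_edge_unique[of b a x y x' y'] \<open>T = {b, a, x, y}\<close> \<open>cyc4 b a x y\<close> assms(1-3)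
        by auto
    qed (use that in blast)
  qed blast
  show ?thesis
  proof (cases "\<exists>c d. S = {a, b, c, d} \<and> cyc4 a b c d")
    case True
    then show ?thesis using *[of S T] assms that by metis
  next
    case False
    then show ?thesis using **[OF False] *[of T S] assms that by (metis Un_commute)
  qed
qed

text \<open>
  Seen from \<open>u\<close>, the square lies behind its side from \<open>a\<close> to \<open>b\<close>.  If \<open>v\<close> were none of the two
  remaining corners, the diagonal from \<open>u\<close> to \<open>v\<close> would leave the square through another side.
\<close>
lemma new_diagonal_end:
  assumes S: "{a, b, c, d} \<in> squares p n D" "cyc4 a b c d"
    and uv: "u < 2 * n + 2" "v < 2 * n + 2" "cyc a u b" "cyc a b v"
    and nc: "\<And>x y. {x, y} \<in> edges n D \<Longrightarrow> {x, y} \<noteq> {a, b} \<Longrightarrow> \<not> interlace x y u v"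
  shows "v = c \<or> v = d"
proof (rule ccontr)
  assume no: "\<not> (v = c \<or> v = d)"
  note q = cyc4_all[OF S(2)] and e = sides_of_square_are_edges[OF S]
  have ne: "{b, c} \<noteq> {a, b}" "{c, d} \<noteq> {a, b}" "{d, a} \<noteq> {a, b}"
    using q[THEN cyc_distinct] by (auto simp: doubleton_eq_iff)
  have "v \<notin> {a, b, c, d}" using no uv cyc_distinct by blast
  then consider "cyc b v c" | "cyc c v d" | "cyc d v a"
    using cyc4_arcs[OF S(2)] uv(4) cyc_asym by blast
  then show False
  proof cases
    case 1
    have "cyc a u c" using cyc_trans[of a u b c] uv q by blast
    moreover have "cyc u b c" using cyc_trans[of a u b c] uv q by blast
    ultimately have "cyc4 b v c u" using 1 cyc_rotate by (simp add: cyc4_def cyc_rotate[of u b c])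
    then show False using nc[OF e(2) ne(1)] unfolding interlace_def by blast
  next
    case 2
    have "cyc u b c" using cyc_trans[of a u b c] uv q by blast
    have "cyc a u c" using cyc_trans[of a u b c] uv q by blast
    then have "cyc u c d" using cyc_trans[of a u c d] uv q by blast
    then have "cyc4 c v d u" using 2 by (simp add: cyc4_def cyc_rotate[of u c d])
    then show False using nc[OF e(3) ne(2)] unfolding interlace_def by blast
  next
    case 3
    have "cyc a u d" using cyc_trans[of a u b d] uv q by blast
    then have "cyc4 d v a u" using 3 by (simp add: cyc4_def cyc_rotate[of d a u])
    then show False using nc[OF e(4) ne(3)] unfolding interlace_def by blast
  qed
qed

text \<open>
  The new diagonal must cross the removed one: otherwise it would be a diagonal of a square,
  whose ends have the same colour.  It then ends at corners of the two squares adjacent to the removed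
  diagonal.  Of the four diagonals that this allows, the colours exclude two.
\<close>
lemma flip_replacement:
  assumes flip: "quadrangulation p n (insert j (D - {{a, b}}))" and ij: "{a, b} \<in> D" "j \<notin> D"
    and wh: "alternating_colouring n wh"
    and S: "{a, b, c, d} \<in> squares p n D" "cyc4 a b c d"
    and T: "{b, a, e, f} \<in> squares p n D" "cyc4 b a e f"
  obtains u v where "j = {u, v}" "u = e \<or> u = f" "v = c \<or> v = d" "wh u \<longleftrightarrow> \<not> wh v"
proof -
  let ?D' = "insert j (D - {{a, b}})"
  interpret D': quadrangulated_polygon p n ?D'
    by unfold_locales (rule flip)
  have jd: "j \<in> diagonals n" using D'.diagonals by blast
  then obtain u v where j: "j = {u, v}" unfolding diagonals_def card_2_iff by blast
  have je: "{u, v} \<in> edges n ?D'" using j unfolding edges_def by blast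
  note uv = diagonalsD[OF jd[unfolded j]]
  have nc: "\<not> interlace x y u v" "\<not> interlace x y v u" if "{x, y} \<in> edges n D" "{x, y} \<noteq> {a, b}" for x y
  proof -
    have "{x, y} \<in> edges n ?D'" using that unfolding edges_def by blast
    then show "\<not> interlace x y u v" "\<not> interlace x y v u"
      using D'.edges_not_interlace je interlace_commute(3) by blast+
  qed
  have cross: "interlace a b u v"
  proof (rule ccontr)
    assume no: "\<not> interlace a b u v"
    have "\<not> interlace x y u v" if xy: "{x, y} \<in> D" for x y
    proof (cases "{x, y} = {a, b}")
      case True
      then show ?thesis using no interlace_commute(2) by (auto simp: doubleton_eq_iff)
    next
      case False
      then show ?thesis using nc xy unfolding edges_def by blast
    qed
    then obtain x y where s: "{u, x, v, y} \<in> squares p n D" "cyc4 u x v y"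
      using noncrossing_diagonal_in_square jd ij(2) unfolding j by blast
    have "wh u \<longleftrightarrow> \<not> wh x" "wh x \<longleftrightarrow> \<not> wh v"
      using sides_of_square_are_edges(1,2)[OF s] edge_colours[OF wh] by blast+
    moreover have "wh u \<longleftrightarrow> \<not> wh v" using D'.edge_colours[OF wh je] .
    ultimately show False by blast
  qed
  have col: "wh u \<longleftrightarrow> \<not> wh v" using D'.edge_colours[OF wh je] .
  have ends: "(u' = e \<or> u' = f) \<and> (v' = c \<or> v' = d)"
    if uv': "cyc a u' b" "cyc a b v'" "{u', v'} = {u, v}" for u' v'
  proof -
    have lt: "u' < 2 * n + 2" "v' < 2 * n + 2" using uv uv'(3) by (auto simp: doubleton_eq_iff)
    have nc': "\<not> interlace x y u' v'" "\<not> interlace x y v' u'" if "{x, y} \<in> edges n D" "{x, y} \<noteq> {a, b}" for x y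
      using nc[OF that] uv'(3) by (auto simp: doubleton_eq_iff)
    have "v' = c \<or> v' = d" using new_diagonal_end[OF S lt uv'(1,2) nc'(1)] by blast
    moreover have "u' = e \<or> u' = f"
    proof (rule new_diagonal_end[OF T lt(2,1)])
      show "cyc b v' a" "cyc b a u'" using uv' cyc_rotate by blast+
      show "\<not> interlace x y v' u'" if "{x, y} \<in> edges n D" "{x, y} \<noteq> {b, a}" for x y
        using nc'(2) that by (simp add: insert_commute)
    qed
    ultimately show ?thesis by blast
  qed
  from cross consider "cyc a u b" "cyc a b v" | "cyc a v b" "cyc a b u"
    using interlace_cyc by blast
  then show ?thesis
  proof cases
    case 1
    then show ?thesis using that[of u v] ends[of u v] j col by blast
  next
    case 2
    then show ?thesis using that[of v u] ends[of v u] j col by (auto simp: insert_commute)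
  qed
qed

end

section \<open>Sides of a hexagon\<close>

text \<open>
  The sides of a convex polygon can be read off from any cyclic list of its vertices, not only from
  the list that starts with the smallest label.
\<close>
lemma sides_of_cyclic_set:
  assumes "distinct vs" "sorted (rotate m vs)" "vs \<noteq> []"
  shows "side (set vs) k = {vs ! ((m + k) mod length vs), vs ! (Suc (m + k) mod length vs)}"
proof -
  have "sorted_list_of_set (set vs) = rotate m vs"
    using assms sorted_list_of_set.idem_if_sorted_distinct[of "rotate m vs"] by simp
  moreover have "card (set vs) = length vs" using assms(1) by (simp add: distinct_card)
  ultimately show ?thesis
    using assms(3) unfolding side_def by (simp add: nth_rotate mod_simps)
qed

lemma hexagon_sorted:
  assumes "cyc4 v1 v4 v5 v0" "cyc4 v4 v1 v2 v3"
  shows "distinct [v0, v1, v2, v3, v4, v5]" "\<exists>m. sorted (rotate m [v0, v1, v2, v3, v4, v5])"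
proof -
  have "(v0 < v1 \<and> v1 < v2 \<and> v2 < v3 \<and> v3 < v4 \<and> v4 < v5) \<or>
    (v1 < v2 \<and> v2 < v3 \<and> v3 < v4 \<and> v4 < v5 \<and> v5 < v0) \<or>
    (v2 < v3 \<and> v3 < v4 \<and> v4 < v5 \<and> v5 < v0 \<and> v0 < v1) \<or>
    (v3 < v4 \<and> v4 < v5 \<and> v5 < v0 \<and> v0 < v1 \<and> v1 < v2) \<or>
    (v4 < v5 \<and> v5 < v0 \<and> v0 < v1 \<and> v1 < v2 \<and> v2 < v3) \<or>
    (v5 < v0 \<and> v0 < v1 \<and> v1 < v2 \<and> v2 < v3 \<and> v3 < v4)"
    using assms unfolding cyc4_def cyc_def by (elim conjE disjE) auto
  then consider (0) "v0 < v1 \<and> v1 < v2 \<and> v2 < v3 \<and> v3 < v4 \<and> v4 < v5" |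
    (1) "v1 < v2 \<and> v2 < v3 \<and> v3 < v4 \<and> v4 < v5 \<and> v5 < v0" |
    (2) "v2 < v3 \<and> v3 < v4 \<and> v4 < v5 \<and> v5 < v0 \<and> v0 < v1" |
    (3) "v3 < v4 \<and> v4 < v5 \<and> v5 < v0 \<and> v0 < v1 \<and> v1 < v2" |
    (4) "v4 < v5 \<and> v5 < v0 \<and> v0 < v1 \<and> v1 < v2 \<and> v2 < v3" |
    (5) "v5 < v0 \<and> v0 < v1 \<and> v1 < v2 \<and> v2 < v3 \<and> v3 < v4" by argo
  note cases = this
  show "distinct [v0, v1, v2, v3, v4, v5]" by (cases rule: cases) auto
  have rot: "rotate 0 [v0, v1, v2, v3, v4, v5] = [v0, v1, v2, v3, v4, v5]"
    "rotate 1 [v0, v1, v2, v3, v4, v5] = [v1, v2, v3, v4, v5, v0]"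
    "rotate 2 [v0, v1, v2, v3, v4, v5] = [v2, v3, v4, v5, v0, v1]"
    "rotate 3 [v0, v1, v2, v3, v4, v5] = [v3, v4, v5, v0, v1, v2]"
    "rotate 4 [v0, v1, v2, v3, v4, v5] = [v4, v5, v0, v1, v2, v3]"
    "rotate 5 [v0, v1, v2, v3, v4, v5] = [v5, v0, v1, v2, v3, v4]"
    by (simp_all add: rotate_drop_take)
  have "sorted (rotate 0 [v0, v1, v2, v3, v4, v5]) \<or> sorted (rotate 1 [v0, v1, v2, v3, v4, v5]) \<or>
    sorted (rotate 2 [v0, v1, v2, v3, v4, v5]) \<or> sorted (rotate 3 [v0, v1, v2, v3, v4, v5]) \<or>
    sorted (rotate 4 [v0, v1, v2, v3, v4, v5]) \<or> sorted (rotate 5 [v0, v1, v2, v3, v4, v5])"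
    unfolding rot by (cases rule: cases) simp_all
  then show "\<exists>m. sorted (rotate m [v0, v1, v2, v3, v4, v5])" by blast
qed

text \<open>
  Each vertex is on two sides.  The hexagon \<open>v0, \<dots>, v5\<close> is cut by its diagonal \<open>{v1, v4}\<close> into the squares \<open>{v1, v4, v5, v0}\<close> and
  \<open>{v4, v1, v2, v3}\<close>.
\<close>
lemma hexagon_sides:
  assumes "cyc4 v1 v4 v5 v0" "cyc4 v4 v1 v2 v3"
    and os: "opposite_sides {v0, v1, v2, v3, v4, v5} s t" and v1: "v1 \<in> s"
  shows "s = {v0, v1} \<and> t = {v3, v4} \<or> s = {v1, v2} \<and> t = {v4, v5}"
proof -
  let ?vs = "[v0, v1, v2, v3, v4, v5]"
  obtain m where m: "sorted (rotate m ?vs)" and dist: "distinct ?vs"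
    using hexagon_sorted[OF assms(1,2)] by blast
  have sides: "side {v0, v1, v2, v3, v4, v5} k = {?vs ! ((m + k) mod 6), ?vs ! (Suc (m + k) mod 6)}" for k
    using sides_of_cyclic_set[OF dist m, of k] by simp
  obtain k where "s = side {v0, v1, v2, v3, v4, v5} k" "t = side {v0, v1, v2, v3, v4, v5} (k + 3)"
    using os unfolding opposite_sides_def by auto
  then have s: "s = {?vs ! ((m + k) mod 6), ?vs ! (Suc (m + k) mod 6)}"
    and t: "t = {?vs ! ((m + (k + 3)) mod 6), ?vs ! (Suc (m + (k + 3)) mod 6)}"
    unfolding sides by auto
  \<comment> \<open>The index in \<open>v0, \<dots>, v5\<close> at which the side \<open>s\<close> starts.\<close>
  define r where "r = (m + k) mod 6"
  have r: "Suc (m + k) mod 6 = Suc r mod 6" "(m + (k + 3)) mod 6 = (r + 3) mod 6"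
    "Suc (m + (k + 3)) mod 6 = (r + 4) mod 6"
    unfolding r_def by presburger+
  have "r < 6" unfolding r_def by simp
  then consider "r = 0" | "r = 1" | "r = 2" | "r = 3" | "r = 4" | "r = 5" by linarith
  then show ?thesis
    using s t v1 dist unfolding r r_def[symmetric] by cases auto
qed

section \<open>The red and the blue polygon on one circle\<close>

text \<open>
  The vertices of both polygons divide the circle into \<open>4 * n + 4\<close> equal arcs: the blue vertex \<open>k\<close> is
  the point \<open>2 * k\<close>, and the red vertex \<open>k\<close> is the point \<open>2 * k + 1\<close>.
\<close>
definition circle_point :: "nat \<Rightarrow> nat \<Rightarrow> complex" where
  "circle_point n m = cis (- (2 * pi * real m / real (4 * n + 4)))"

lemma blue_circle: "blue n k = circle_point n (2 * k)"
proof -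
  have "2 * pi * real k / real (2 * n + 2) = 2 * pi * real (2 * k) / real (4 * n + 4)"
    by (simp add: field_simps)
  then show ?thesis unfolding blue_def circle_point_def by simp
qed

lemma red_circle: "red n k = circle_point n (2 * k + 1)"
proof -
  have "- (2 * pi / real (4 * n + 4)) + - (2 * pi * real (2 * k) / real (4 * n + 4)) =
    - (2 * pi * real (2 * k + 1) / real (4 * n + 4))"
    unfolding minus_add_distrib[symmetric] add_divide_distrib[symmetric]
    by (simp add: algebra_simps)
  then show ?thesis unfolding red_def blue_circle circle_point_def cis_mult by simp
qed

lemma clockwise_circle: "clockwise (circle_point n) (4 * n + 4)"
proof
  show "3 \<le> 4 * n + 4" by simp
  fix a b c :: nat assume abc: "a < b" "b < c" "c < 4 * n + 4"
  let ?M = "real (4 * n + 4)"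
  have pos: "0 < sin ((2 * pi * real y / ?M - 2 * pi * real x / ?M) / 2)"
    if "x < y" "y < 4 * n + 4" for x y
  proof -
    have "(2 * pi * s / M - 2 * pi * t / M) / 2 = pi * ((s - t) / M)" for s t M :: real
      by (simp add: diff_divide_distrib right_diff_distrib)
    from this[of "real y" ?M "real x"]
    have eq: "(2 * pi * real y / ?M - 2 * pi * real x / ?M) / 2 = pi * (real (y - x) / ?M)"
      using that(1) by (simp only: of_nat_diff[OF less_imp_le])
    have "0 < real (y - x) / ?M" "real (y - x) / ?M < 1" using that by auto
    then have "0 < pi * (real (y - x) / ?M)" "pi * (real (y - x) / ?M) < pi * 1"
      by (intro mult_pos_pos mult_strict_left_mono; simp)+
    then show ?thesis unfolding eq by (intro sin_gt_zero) (simp_all only: mult_1_right)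
  qed
  show "0 < turn (circle_point n a) (circle_point n b) (circle_point n c)"
    unfolding circle_point_def turn_cis using pos abc by simp
qed

lemma polygon_blue: "1 \<le> n \<Longrightarrow> polygon (blue n) n"
  using clockwise.turn_increasing[OF clockwise_circle[of n]]
  by unfold_locales (auto simp: blue_circle)

lemma polygon_red: "1 \<le> n \<Longrightarrow> polygon (red n) n"
  using clockwise.turn_increasing[OF clockwise_circle[of n]]
  by unfold_locales (auto simp: red_circle)

text \<open>
  The position of the red vertex \<open>v\<close> with respect to the blue edge from \<open>w\<close> to \<open>b\<close>: clockwise from \<open>w\<close>
  come first the vertices on its left, then \<open>b\<close>, then those on its right.
\<close>
definition left_of :: "nat \<Rightarrow> nat \<Rightarrow> nat \<Rightarrow> bool" where
  "left_of w b v \<longleftrightarrow> cyc (2 * w) (2 * v + 1) (2 * b)"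

definition right_of :: "nat \<Rightarrow> nat \<Rightarrow> nat \<Rightarrow> bool" where
  "right_of w b v \<longleftrightarrow> cyc (2 * w) (2 * b) (2 * v + 1)"

lemma left_or_right:
  assumes "w \<noteq> b" shows "left_of w b v \<longleftrightarrow> \<not> right_of w b v"
proof -
  have "2 * w \<noteq> 2 * v + 1" "2 * b \<noteq> 2 * v + 1" "2 * w \<noteq> 2 * b" using assms by presburger+
  then show ?thesis unfolding left_of_def right_of_def using cyc_total cyc_asym by metis
qed

text \<open>
  The orientation of the pair of directions is the difference of the oriented areas of the ends of the red
  edge with respect to the blue edge.  Compatibility thus says that a red edge which crosses a blue edge
  does so from left to right.
\<close>
lemma compatible_edge_direction:
  assumes n: "1 \<le> n" and c: "compatible n wh {l, r} {w, b}"
    and lt: "l < 2 * n + 2" "r < 2 * n + 2" "w < 2 * n + 2" "b < 2 * n + 2"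
    and wh: "wh l" "\<not> wh r" "wh w" "\<not> wh b"
    and right: "right_of w b l"
  shows "right_of w b r"
proof (rule ccontr)
  interpret circle: clockwise "circle_point n" "4 * n + 4" by (rule clockwise_circle)
  interpret red: polygon "red n" n by (rule polygon_red[OF n])
  interpret blue: polygon "blue n" n by (rule polygon_blue[OF n])
  assume "\<not> right_of w b r"
  have ne: "w \<noteq> b" "l \<noteq> r" using wh by auto
  then have left: "left_of w b r" using \<open>\<not> right_of w b r\<close> left_or_right by blast
  have lt': "2 * l + 1 < 4 * n + 4" "2 * r + 1 < 4 * n + 4" "2 * w < 4 * n + 4" "2 * b < 4 * n + 4"
    using lt by auto
  have "cyc4 (2 * w) (2 * r + 1) (2 * b) (2 * l + 1)"
    using left right unfolding left_of_def right_of_def cyc4_def by blast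
  then have "interlace (2 * w) (2 * b) (2 * r + 1) (2 * l + 1)"
    unfolding interlace_def by blast
  then have "interlace (2 * l + 1) (2 * r + 1) (2 * w) (2 * b)"
    using interlace_commute by blast
  then have "open_segment (red n l) (red n r) \<inter> open_segment (blue n w) (blue n b) \<noteq> {}"
    unfolding red_circle blue_circle using circle.crosses_if_interlace[OF lt'] by blast
  then have "crosses (red n) {l, r} (blue n) {w, b}"
    unfolding crosses_def using red.open_edge_segment blue.open_edge_segment lt ne by simp
  then have "positive_basis (direction (red n) wh {l, r}) (direction (blue n) wh {w, b})"
    using c unfolding compatible_def by blast
  then have "0 < Im (cnj (red n r - red n l) * (blue n b - blue n w))"
    unfolding positive_basis_def direction_def
    by (simp add: white_end_eq[OF wh(1,2)] black_end_eq[OF wh(1,2)]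
        white_end_eq[OF wh(3,4)] black_end_eq[OF wh(3,4)])
  also have "Im (cnj (red n r - red n l) * (blue n b - blue n w)) =
    turn (blue n w) (blue n b) (red n r) - turn (blue n w) (blue n b) (red n l)"
    by (simp add: turn_def algebra_simps)
  finally have "turn (blue n w) (blue n b) (red n l) < turn (blue n w) (blue n b) (red n r)" by simp
  moreover have "0 < turn (blue n w) (blue n b) (red n l)" "turn (blue n w) (blue n b) (red n r) < 0"
    unfolding red_circle blue_circle
    using circle.turn_cyc circle.turn_cyc_neg left right lt' unfolding left_of_def right_of_def
    by blast+
  ultimately show False by simp
qed

section \<open>Oriented flips\<close>

text \<open>
  Red vertices are compared in the clockwise order that starts at the blue vertex \<open>w\<close>.
\<close>
definition before :: "nat \<Rightarrow> nat \<Rightarrow> nat \<Rightarrow> bool" where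
  "before w u v \<longleftrightarrow> u = v \<or> cyc (2 * w) (2 * u + 1) (2 * v + 1)"

lemma before_refl: "before w u u"
  by (simp add: before_def)

lemma not_before: "\<not> before w u v \<Longrightarrow> cyc (2 * w) (2 * v + 1) (2 * u + 1)"
proof -
  have "2 * w \<noteq> 2 * u + 1" "2 * w \<noteq> 2 * v + 1" by presburger+
  then show "\<not> before w u v \<Longrightarrow> cyc (2 * w) (2 * v + 1) (2 * u + 1)"
    using cyc_total[of "2 * w" "2 * u + 1" "2 * v + 1"] unfolding before_def by auto
qed

lemma before_trans: "before w u v \<Longrightarrow> before w v z \<Longrightarrow> before w u z"
  unfolding before_def using cyc_trans by blast

text \<open>
  The combinatorial content of an oriented flip in the hexagon \<open>v0, \<dots>, v5\<close>, numbered clockwise such that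
  the long inner edge from \<open>w\<close> to \<open>b\<close> enters through \<open>{v0, v1}\<close> and leaves through \<open>{v3, v4}\<close>; the
  diagonal \<open>{v1, v4}\<close> is replaced by \<open>{v0, v3}\<close>.
\<close>
definition flip_at ::
    "nat \<Rightarrow> (nat \<Rightarrow> bool) \<Rightarrow> nat set set \<Rightarrow> nat set set \<Rightarrow> nat set set \<Rightarrow>
      nat \<Rightarrow> nat \<Rightarrow> nat \<Rightarrow> nat \<Rightarrow> nat \<Rightarrow> nat \<Rightarrow> nat \<Rightarrow> nat \<Rightarrow> bool" where
  "flip_at n wh Q x y v0 v1 v2 v3 v4 v5 w b \<longleftrightarrow>
     {v1, v4} \<in> x \<and> {v0, v3} \<notin> x \<and> y = insert {v0, v3} (x - {{v1, v4}}) \<and>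
     {v4, v1, v2, v3} \<in> squares (red n) n x \<and> cyc4 v4 v1 v2 v3 \<and>
     {v1, v4, v5, v0} \<in> squares (red n) n x \<and> cyc4 v1 v4 v5 v0 \<and>
     wh v1 \<and> wh v3 \<and> \<not> wh v0 \<and> \<not> wh v4 \<and>
     {w, b} \<in> Q \<and> wh w \<and> \<not> wh b \<and>
     cyc (2 * v0 + 1) (2 * w) (2 * v1 + 1) \<and> cyc (2 * v3 + 1) (2 * b) (2 * v4 + 1)"

locale flip_setting =
  fixes n :: nat and wh :: "nat \<Rightarrow> bool" and Q :: "nat set set"
  assumes n: "1 \<le> n"
    and wh: "alternating_colouring n wh"
    and Q: "quadrangulation (blue n) n Q"
begin

sublocale blue: quadrangulated_polygon "blue n" n Q
proof -
  interpret polygon "blue n" n by (rule polygon_blue[OF n])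
  show "quadrangulated_polygon (blue n) n Q" by unfold_locales (rule Q)
qed

abbreviation compat :: "nat set set set" where
  "compat \<equiv> compatible_quadrangulations n wh Q"

lemma red_quadrangulated:
  assumes "x \<in> compat"
  shows "quadrangulated_polygon (red n) n x"
proof -
  interpret polygon "red n" n by (rule polygon_red[OF n])
  show ?thesis
    by unfold_locales (use assms in \<open>simp add: compatible_quadrangulations_def\<close>)
qed

lemma no_wrong_crossing:
  assumes x: "x \<in> compat" and e: "{l, r} \<in> edges n x" and d: "{w, b} \<in> Q"
    and col: "wh l" "wh w" "\<not> wh b" and right: "right_of w b l"
  shows "right_of w b r"
proof -
  interpret x: quadrangulated_polygon "red n" n x by (rule red_quadrangulated[OF x])
  have "{w, b} \<in> edges n Q" using d unfolding edges_def by blast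
  moreover have "compatible n wh {l, r} {w, b}"
    using x e calculation unfolding compatible_quadrangulations_def compatible_edge_def by blast
  moreover have "\<not> wh r" using x.edge_colours[OF wh e] col by blast
  ultimately show ?thesis
    using compatible_edge_direction[OF n _ x.edgesD(1,2)[OF e] blue.edgesD(1,2)] col right by blast
qed

text \<open>
  The white end \<open>v1\<close> of the removed diagonal lies on the entry side, which is one of the two sides of the
  hexagon at \<open>v1\<close>.  It is not \<open>{v1, v2}\<close>: a long edge entering there would have the white vertex \<open>v1\<close>
  on its right and the black vertex \<open>v2\<close> on its left.  The exit side is then \<open>{v3, v4}\<close>, and of the two
  diagonals that may replace \<open>{v1, v4}\<close> only \<open>{v0, v3}\<close> has its white end on it.
\<close>
lemma oriented_flip_at:
  assumes "oriented_flip n wh Q x y"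
  obtains v0 v1 v2 v3 v4 v5 w b where "flip_at n wh Q x y v0 v1 v2 v3 v4 v5 w b"
proof -
  from assms obtain i j H d s t where x: "x \<in> compat" and y: "y \<in> compat"
    and ij: "i \<in> x" "j \<notin> x" "y = insert j (x - {i})" and H: "flip_hexagon n x i H"
    and d: "d \<in> Q" and st: "opposite_sides H s t" and cb: "crosses_before n wh d s t"
    and ends: "white_end wh i \<in> s" "white_end wh j \<in> t"
    unfolding oriented_flip_def by blast
  interpret x: quadrangulated_polygon "red n" n x by (rule red_quadrangulated[OF x])
  interpret circle: clockwise "circle_point n" "4 * n + 4" by (rule clockwise_circle)
  have two_coloured: "\<exists>a b. e = {a, b} \<and> wh a \<and> \<not> wh b"
    if e: "e \<in> D" and D: "quadrangulated_polygon p n D" for e D p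
  proof -
    interpret D: quadrangulated_polygon p n D by (rule D)
    obtain a b where ab: "e = {a, b}"
      using e D.diagonals unfolding diagonals_def card_2_iff by blast
    have "{a, b} \<in> edges n D" using e ab unfolding edges_def by blast
    then have "wh a \<longleftrightarrow> \<not> wh b" using D.edge_colours[OF wh] by blast
    then show ?thesis using ab by (metis insert_commute)
  qed
  obtain v1 v4 where i: "i = {v1, v4}" and col1: "wh v1" "\<not> wh v4"
    using two_coloured[OF ij(1) x.quadrangulated_polygon_axioms] by blast
  obtain w b where db: "d = {w, b}" and cold: "wh w" "\<not> wh b"
    using two_coloured[OF d blue.quadrangulated_polygon_axioms] by blast
  have i': "{v4, v1} \<in> x" using ij(1) i by (simp add: insert_commute)
  obtain S T where "S \<in> squares (red n) n x" "T \<in> squares (red n) n x" "S \<noteq> T"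
    "{v4, v1} \<subseteq> S" "{v4, v1} \<subseteq> T" and HST: "H = S \<union> T"
    using H i unfolding flip_hexagon_def by blast
  from x.squares_adjacent_to_edge[OF this(1-3) i' this(4,5)]
  obtain v2 v3 v5 v0 where
    S: "{v4, v1, v2, v3} \<in> squares (red n) n x" "cyc4 v4 v1 v2 v3" and
    T: "{v1, v4, v5, v0} \<in> squares (red n) n x" "cyc4 v1 v4 v5 v0" and
    ST: "S \<union> T = {v4, v1, v2, v3, v5, v0}" by metis
  have Hv: "H = {v0, v1, v2, v3, v4, v5}" using ST HST by auto
  note eS = x.sides_of_square_are_edges[OF S] and eT = x.sides_of_square_are_edges[OF T]
  have col2: "\<not> wh v2" "wh v3" "wh v5" "\<not> wh v0"
    using x.edge_colours[OF wh eS(2)] x.edge_colours[OF wh eS(3)] x.edge_colours[OF wh eT(2)]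
      x.edge_colours[OF wh eT(3)] col1 by blast+
  have s1: "v1 \<in> s" using ends(1) white_end_eq[OF col1] i by simp
  have sides: "s = {v0, v1} \<and> t = {v3, v4} \<or> s = {v1, v2} \<and> t = {v4, v5}"
    using hexagon_sides[OF T(2) S(2) _ s1] st Hv by blast
  note ltS = x.square_lt[OF S(1)] and ltT = x.square_lt[OF T(1)]
  have dE: "{w, b} \<in> edges n Q" using d db unfolding edges_def by blast
  note ltd = blue.edgesD[OF dE]
  have cross: "cyc (2 * a + 1) (2 * w) (2 * a' + 1) \<and> cyc (2 * c + 1) (2 * b) (2 * c' + 1)"
    if st: "s = {a, a'}" "t = {c, c'}" and q: "cyc4 a a' c c'"
      and lt: "a < 2 * n + 2" "a' < 2 * n + 2" "c < 2 * n + 2" "c' < 2 * n + 2" for a a' c c'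
  proof -
    obtain X Y where XY: "0 < X" "X < Y" "Y < 1"
      "linepath (blue n w) (blue n b) X \<in> open_edge (red n) s"
      "linepath (blue n w) (blue n b) Y \<in> open_edge (red n) t"
      using cb white_end_eq[OF cold] black_end_eq[OF cold] unfolding crosses_before_def db by auto
    have ne: "a \<noteq> a'" "c \<noteq> c'" using cyc4_all[OF q, THEN cyc_distinct] by blast+
    have "linepath (circle_point n (2 * w)) (circle_point n (2 * b)) X \<in>
      open_segment (circle_point n (2 * a + 1)) (circle_point n (2 * a' + 1))"
      using XY(4) x.open_edge_segment[OF lt(1,2) ne(1)] unfolding st red_circle blue_circle by simp
    moreover have "linepath (circle_point n (2 * w)) (circle_point n (2 * b)) Y \<in>
      open_segment (circle_point n (2 * c + 1)) (circle_point n (2 * c' + 1))"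
      using XY(5) x.open_edge_segment[OF lt(3,4) ne(2)] unfolding st red_circle blue_circle by simp
    moreover have "cyc4 (2 * a + 1) (2 * a' + 1) (2 * c + 1) (2 * c' + 1)"
      unfolding cyc4_odd by (rule q)
    ultimately show ?thesis
      using lt ltd by (intro circle.crossing_order[OF _ _ _ _ _ _ _ XY(1-3)]) simp_all
  qed
  have o: "cyc4 v0 v1 v3 v4" "cyc4 v1 v2 v4 v5"
  proof -
    have "cyc v1 v3 v4" "cyc v1 v4 v0" "cyc v1 v2 v4" "cyc v1 v4 v5"
      using cyc4_all[OF S(2)] cyc4_all[OF T(2)] by blast+
    then show "cyc4 v1 v2 v4 v5" unfolding cyc4_def by blast
    have "cyc4 v1 v3 v4 v0" using \<open>cyc v1 v3 v4\<close> \<open>cyc v1 v4 v0\<close> unfolding cyc4_def by blast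
    then show "cyc4 v0 v1 v3 v4" using cyc4_rotate by blast
  qed
  \<comment> \<open>The wrong entry side is excluded by the compatibility of \<open>{v1, v2}\<close> with the long inner edge.\<close>
  have not1: "\<not> (s = {v1, v2} \<and> t = {v4, v5})"
  proof
    assume "s = {v1, v2} \<and> t = {v4, v5}"
    then have c: "cyc (2 * v1 + 1) (2 * w) (2 * v2 + 1)" "cyc (2 * v4 + 1) (2 * b) (2 * v5 + 1)"
      using cross[of v1 v2 v4 v5] o ltS ltT by blast+
    then have "cyc (2 * w) (2 * v2 + 1) (2 * b)" "cyc (2 * w) (2 * b) (2 * v1 + 1)"
      using arcs_order(5,6)[OF cyc4_odd[THEN iffD2, OF o(2)]] by blast+
    then have "right_of w b v1" "left_of w b v2" unfolding left_of_def right_of_def by blast+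
    moreover have "right_of w b v2"
      using no_wrong_crossing[OF x eS(2) _ col1(1) cold] calculation d db by blast
    ultimately show False using left_or_right ltd(3) by blast
  qed
  then have st': "s = {v0, v1}" "t = {v3, v4}" using sides by blast+
  then have c: "cyc (2 * v0 + 1) (2 * w) (2 * v1 + 1)" "cyc (2 * v3 + 1) (2 * b) (2 * v4 + 1)"
    using cross[of v0 v1 v3 v4] o ltS ltT by blast+
  have "quadrangulation (red n) n (insert j (x - {{v4, v1}}))"
    using y ij(3) i unfolding compatible_quadrangulations_def by (simp add: insert_commute)
  from x.flip_replacement[OF this i' ij(2) wh S T]
  obtain u v where j: "j = {u, v}" "u = v5 \<or> u = v0" "v = v2 \<or> v = v3" "wh u \<longleftrightarrow> \<not> wh v" by metis
  have "\<not> (u = v5 \<and> v = v2)"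
  proof
    assume "u = v5 \<and> v = v2"
    then have "v5 \<in> t" using ends(2) white_end_eq[of wh v5 v2] col2 j(1) by simp
    then show False using st'(2) cyc4_all[OF T(2), THEN cyc_distinct]
        hexagon_sorted(1)[OF T(2) S(2)] by auto
  qed
  then have jj: "j = {v0, v3}" using j col2 by auto
  have "flip_at n wh Q x y v0 v1 v2 v3 v4 v5 w b"
    unfolding flip_at_def using ij i jj S T col1 col2 d db cold c by blast
  then show ?thesis by (rule that)
qed

text \<open>
  The removed edge and its colours fix \<open>v1\<close> and \<open>v4\<close>, hence the two squares and the rest of the hexagon.
\<close>
lemma flip_at_unique:
  assumes x: "x \<in> compat" and f: "flip_at n wh Q x y v0 v1 v2 v3 v4 v5 w b"
    and f': "flip_at n wh Q x y' u0 u1 u2 u3 u4 u5 w' b'" and eq: "{v1, v4} = {u1, u4}"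
  shows "y = y'"
proof -
  interpret x: quadrangulated_polygon "red n" n x by (rule red_quadrangulated[OF x])
  have u: "u1 = v1" "u4 = v4" using eq f f' unfolding flip_at_def doubleton_eq_iff by auto
  have "v3 = u3" "v0 = u0"
    using x.square_at_edge_unique[of v4 v1 v2 v3 u2 u3] x.square_at_edge_unique[of v1 v4 v5 v0 u5 u0]
      f f' unfolding flip_at_def u by blast+
  then show ?thesis using f f' unfolding flip_at_def u by blast
qed

section \<open>The shadow of a quadrangulation\<close>

text \<open>
  Along an edge of \<open>Q\<close> from \<open>w\<close> to \<open>b\<close>, a red edge crossing it is recorded as the pair of its left, white
  end and its right, black end.  Both coordinates are counted from \<open>w\<close>: clockwise for the left ends and
  counterclockwise for the right ends.  In these coordinates the crossing edges are points of a
  monotone staircase, and a flip at a long inner edge turns a corner of this staircase to its other side.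
  The shadow collects the pairs on one side of the staircases, for all edges of \<open>Q\<close> at once: \<open>(l', r')\<close>
  casts a shadow on \<open>(l, r)\<close> if, in these coordinates, \<open>l\<close> is at or beyond \<open>l'\<close> and \<open>r\<close> is not beyond \<open>r'\<close>.
\<close>
definition shadow :: "nat set set \<Rightarrow> (nat \<times> nat \<times> nat \<times> nat) set" where
  "shadow x = {(w, b, l, r). {w, b} \<in> Q \<and> wh w \<and> \<not> wh b \<and>
     (\<exists>l' r'. {l', r'} \<in> edges n x \<and> wh l' \<and> \<not> wh r' \<and> left_of w b l' \<and> right_of w b r' \<and>
       before w l' l \<and> before w r' r)}"

text \<open>
  Only the new diagonal \<open>{v0, v3}\<close> could enlarge the shadow.  If an edge of \<open>Q\<close> crosses it, consider
  the old diagonal \<open>{v1, v4}\<close>.  If \<open>v1\<close> is on the left, then \<open>{v1, v0}\<close> also crosses and casts a larger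
  shadow.  If \<open>v1\<close> is on the right, so is \<open>v4\<close> by compatibility, and \<open>{v3, v4}\<close> casts a larger shadow.
\<close>
lemma flip_shadow_mono:
  assumes x: "x \<in> compat" and f: "flip_at n wh Q x y v0 v1 v2 v3 v4 v5 w b"
  shows "shadow y \<subseteq> shadow x"
proof
  interpret x: quadrangulated_polygon "red n" n x by (rule red_quadrangulated[OF x])
  fix q assume q: "q \<in> shadow y"
  then obtain w b l r l' r' where q_eq: "q = (w, b, l, r)" and d: "{w, b} \<in> Q" "wh w" "\<not> wh b"
    and e: "{l', r'} \<in> edges n y" "wh l'" "\<not> wh r'" "left_of w b l'" "right_of w b r'"
    and lr: "before w l' l" "before w r' r"
    unfolding shadow_def by blast
  have col: "wh v1" "wh v3" "\<not> wh v0" "\<not> wh v4" and i: "{v1, v4} \<in> edges n x"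
    using f unfolding flip_at_def edges_def by blast+
  have S: "{v4, v1, v2, v3} \<in> squares (red n) n x" "cyc4 v4 v1 v2 v3"
    and T: "{v1, v4, v5, v0} \<in> squares (red n) n x" "cyc4 v1 v4 v5 v0"
    using f unfolding flip_at_def by blast+
  have s: "{v1, v0} \<in> edges n x" and t: "{v3, v4} \<in> edges n x"
    using x.sides_of_square_are_edges(4)[OF S] x.sides_of_square_are_edges(4)[OF T]
    by (simp_all add: insert_commute)
  \<comment> \<open>It suffices to find an edge of \<open>x\<close> that casts a larger shadow.\<close>
  have in_shadow: "q \<in> shadow x"
    if "{l'', r''} \<in> edges n x" "wh l''" "\<not> wh r''" "left_of w b l''" "right_of w b r''"
      "before w l'' l'" "before w r'' r'" for l'' r''
  proof -
    have "before w l'' l" "before w r'' r"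
      using before_trans that lr by blast+
    then show ?thesis unfolding shadow_def q_eq using d that by blast
  qed
  show "q \<in> shadow x"
  proof (cases "{l', r'} \<in> edges n x")
    case True
    then show ?thesis using in_shadow e before_refl by blast
  next
    case False
    then have "{l', r'} = {v0, v3}" using e(1) f unfolding flip_at_def edges_def by blast
    then have lr': "l' = v3" "r' = v0" using e(2,3) col by (auto simp: doubleton_eq_iff)
    \<comment> \<open>Positions of the vertices on the common circle.\<close>
    let ?W = "2 * w" and ?B = "2 * b" and ?V0 = "2 * v0 + 1" and ?V1 = "2 * v1 + 1"
      and ?V3 = "2 * v3 + 1" and ?V4 = "2 * v4 + 1"
    have W3B: "cyc ?W ?V3 ?B" and WB0: "cyc ?W ?B ?V0"
      using e lr' unfolding left_of_def right_of_def by blast+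
    have "w \<noteq> b" using d by blast
    have o: "cyc v0 v1 v3" "cyc v3 v4 v0"
    proof -
      have "cyc v1 v3 v4" "cyc v1 v4 v0" using cyc4_all[OF S(2)] cyc4_all[OF T(2)] by blast+
      then have "cyc4 v1 v3 v4 v0" unfolding cyc4_def by blast
      from cyc4_all(6,10)[OF this] show "cyc v0 v1 v3" "cyc v3 v4 v0" .
    qed
    show ?thesis
    proof (cases "left_of w b v1")
      case True
      have "before w v1 v3"
      proof (rule ccontr)
        assume "\<not> before w v1 v3"
        then have "cyc ?W ?V3 ?V1"
          by (rule not_before)
        moreover have "cyc ?W ?V1 ?V0"
          using True WB0 cyc_trans unfolding left_of_def by blast
        ultimately have "cyc ?V3 ?V1 ?V0" using cyc_trans by blast
        then have "cyc v3 v1 v0" unfolding cyc_odd .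
        then show False using o(1) cyc_rotate cyc_asym by blast
      qed
      then show ?thesis using in_shadow[OF s] True e col lr' before_refl by blast
    next
      case False
      then have "right_of w b v1" using left_or_right \<open>w \<noteq> b\<close> by blast
      then have v4: "right_of w b v4" using no_wrong_crossing[OF x i d(1) col(1) d(2,3)] by blast
      have "before w v4 v0"
      proof (rule ccontr)
        assume "\<not> before w v4 v0"
        then have "cyc ?W ?V0 ?V4"
          by (rule not_before)
        moreover have "cyc ?W ?V3 ?V0" using W3B WB0 cyc_trans by blast
        ultimately have "cyc ?V3 ?V0 ?V4" using cyc_trans by blast
        then have "cyc v3 v0 v4" unfolding cyc_odd .
        then show False using o(2) cyc_asym by blast
      qed
      then show ?thesis using in_shadow[OF t] v4 e col lr' before_refl by blast
    qed
  qed
qed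

text \<open>
  The lost element is the removed diagonal itself, as seen from a long inner edge.  An edge of the new
  quadrangulation that still covered it could cross neither \<open>{v0, v1}\<close> nor \<open>{v3, v4}\<close>, which forces it to
  have the ends \<open>v1\<close> and \<open>v4\<close>.
\<close>
lemma flip_shadow_strict:
  assumes x: "x \<in> compat" and y: "y \<in> compat" and f: "flip_at n wh Q x y v0 v1 v2 v3 v4 v5 w b"
  shows "left_of w b v1" "right_of w b v4" "(w, b, v1, v4) \<in> shadow x" "(w, b, v1, v4) \<notin> shadow y"
proof -
  interpret x: quadrangulated_polygon "red n" n x by (rule red_quadrangulated[OF x])
  interpret y: quadrangulated_polygon "red n" n y by (rule red_quadrangulated[OF y])
  have col: "wh v1" "wh v3" "\<not> wh v0" "\<not> wh v4" and d: "{w, b} \<in> Q" "wh w" "\<not> wh b"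
    and i: "{v1, v4} \<in> x" and y_eq: "y = insert {v0, v3} (x - {{v1, v4}})"
    and arcs: "cyc (2 * v0 + 1) (2 * w) (2 * v1 + 1)" "cyc (2 * v3 + 1) (2 * b) (2 * v4 + 1)"
    using f unfolding flip_at_def by blast+
  have S: "{v4, v1, v2, v3} \<in> squares (red n) n x" "cyc4 v4 v1 v2 v3"
    and T: "{v1, v4, v5, v0} \<in> squares (red n) n x" "cyc4 v1 v4 v5 v0"
    using f unfolding flip_at_def by blast+
  let ?W = "2 * w" and ?B = "2 * b" and ?V0 = "2 * v0 + 1" and ?V1 = "2 * v1 + 1"
    and ?V3 = "2 * v3 + 1" and ?V4 = "2 * v4 + 1"
  have "cyc v1 v3 v4" "cyc v1 v4 v0" using cyc4_all[OF S(2)] cyc4_all[OF T(2)] by blast+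
  then have "cyc4 v1 v3 v4 v0" unfolding cyc4_def by blast
  then have o: "cyc4 v0 v1 v3 v4" using cyc4_rotate by blast
  note ord = arcs_order[OF cyc4_odd[THEN iffD2, OF o] arcs]
  show left: "left_of w b v1" and right: "right_of w b v4"
    using ord unfolding left_of_def right_of_def by blast+
  have "{v1, v4} \<in> edges n x" using i unfolding edges_def by blast
  then show "(w, b, v1, v4) \<in> shadow x"
    unfolding shadow_def using d col left right before_refl by blast
  have "{v1, v0} \<in> edges n x" "{v3, v4} \<in> edges n x"
    using x.sides_of_square_are_edges(4)[OF S] x.sides_of_square_are_edges(4)[OF T]
    by (simp_all add: insert_commute)
  moreover have "{v1, v0} \<noteq> {v1, v4}" "{v3, v4} \<noteq> {v1, v4}"
    using cyc4_all[OF o] cyc_distinct unfolding doubleton_eq_iff by blast+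
  ultimately have s: "{v1, v0} \<in> edges n y" and t: "{v3, v4} \<in> edges n y"
    unfolding y_eq edges_def by blast+
  show "(w, b, v1, v4) \<notin> shadow y"
  proof
    assume "(w, b, v1, v4) \<in> shadow y"
    then obtain l r where e: "{l, r} \<in> edges n y" "wh l" "\<not> wh r" "left_of w b l" "right_of w b r"
      and b: "before w l v1" "before w r v4"
      unfolding shadow_def by blast
    let ?L = "2 * l + 1" and ?R = "2 * r + 1"
    have W1R: "cyc ?W ?V1 ?R" and W3R: "cyc ?W ?V3 ?R"
      using ord e(5) cyc_trans unfolding right_of_def by blast+
    have WR0: "cyc ?W ?R ?V0"
      using b(2) ord(4) cyc_trans unfolding before_def by blast
    have "l = v1"
    proof (rule ccontr)
      assume "l \<noteq> v1"
      then have "cyc ?W ?L ?V1" using b(1) unfolding before_def by blast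
      then have "cyc ?L ?V1 ?R" "cyc ?L ?R ?V0" using W1R WR0 cyc_trans by blast+
      then have "cyc4 l v1 r v0" unfolding cyc_odd cyc4_def by blast
      then have "interlace l r v1 v0" unfolding interlace_def by blast
      then show False using y.edges_not_interlace[OF e(1) s] by blast
    qed
    moreover have "r = v4"
    proof (rule ccontr)
      assume "r \<noteq> v4"
      then have "cyc ?W ?R ?V4" using b(2) unfolding before_def by blast
      then have "cyc ?V1 ?V3 ?R" "cyc ?V1 ?R ?V4" using W1R W3R ord(1) cyc_trans by blast+
      then have "cyc4 v1 v3 r v4" unfolding cyc_odd cyc4_def by blast
      then have "interlace v1 r v3 v4" unfolding interlace_def by blast
      then show False using y.edges_not_interlace[OF e(1) t] \<open>l = v1\<close> by blast
    qed
    ultimately have "{v1, v4} \<in> edges n y" using e(1) by blast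
    moreover have "{v1, v4} \<notin> boundary_edges n" using i x.diagonals diagonalsD(4) by blast
    moreover have "{v1, v4} \<noteq> {v0, v3}" using col cyc4_all[OF o] cyc_distinct
      unfolding doubleton_eq_iff by blast
    ultimately show False unfolding edges_def y_eq by blast
  qed
qed

lemma flip_graph_shadow:
  assumes "(x, y) \<in> flip_graph n wh Q"
  shows "shadow y \<subset> shadow x"
proof -
  have f: "oriented_flip n wh Q x y" using assms unfolding flip_graph_def by simp
  then have xy: "x \<in> compat" "y \<in> compat" unfolding oriented_flip_def by blast+
  from oriented_flip_at[OF f] flip_shadow_mono[OF xy(1)] flip_shadow_strict(3,4)[OF xy]
  show ?thesis by (metis psubsetI)
qed

lemma flip_path_shadow:
  assumes "(x, y) \<in> (flip_graph n wh Q)\<^sup>+"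
  shows "shadow y \<subset> shadow x"
  using assms by induction (use flip_graph_shadow in \<open>blast dest: psubset_trans\<close>)+

text \<open>
  The first flip towards \<open>z\<close> removes an edge \<open>i\<close> and takes \<open>i\<close>, as a pair of ends, out of the shadow.
  Shadows only shrink, so \<open>i\<close> is not an edge of \<open>y\<close>; but the flip from \<open>x\<close> to \<open>y\<close> removes a single edge,
  so it is the flip at \<open>i\<close> as well.  Since there is only one flip at \<open>i\<close>, this gives \<open>z = y\<close>, and the path from
  \<open>z\<close> to \<open>y\<close> would be a cycle.
\<close>
lemma flip_no_shortcut:
  assumes xy: "(x, y) \<in> flip_graph n wh Q" and xz: "(x, z) \<in> flip_graph n wh Q"
    and zy: "(z, y) \<in> (flip_graph n wh Q)\<^sup>+"
  shows False
proof -
  have fy: "oriented_flip n wh Q x y" and fz: "oriented_flip n wh Q x z"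
    using xy xz unfolding flip_graph_def by simp_all
  have comp: "x \<in> compat" "z \<in> compat" using fz unfolding oriented_flip_def by blast+
  obtain v0 v1 v2 v3 v4 v5 w b where f: "flip_at n wh Q x z v0 v1 v2 v3 v4 v5 w b"
    using oriented_flip_at[OF fz] .
  obtain u0 u1 u2 u3 u4 u5 w' b' where f': "flip_at n wh Q x y u0 u1 u2 u3 u4 u5 w' b'"
    using oriented_flip_at[OF fy] .
  have "(w, b, v1, v4) \<notin> shadow y"
    using flip_shadow_strict(4)[OF comp f] flip_path_shadow[OF zy] by blast
  moreover have "(w, b, v1, v4) \<in> shadow y" if "{v1, v4} \<noteq> {u1, u4}"
  proof -
    have "{v1, v4} \<in> edges n y" using that f f' unfolding flip_at_def edges_def by blast
    then show ?thesis
      using f flip_shadow_strict(1,2)[OF comp f] before_refl unfolding shadow_def flip_at_def by blast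
  qed
  ultimately have "{v1, v4} = {u1, u4}" by blast
  then have "z = y" using flip_at_unique[OF comp(1) f f'] by blast
  then show False using flip_path_shadow[OF zy] by blast
qed

end

section \<open>The order of reachability\<close>

text \<open>
  The order is reachability.  In an acyclic graph every covering relation of reachability is an arrow, and
  an arrow is a covering relation unless another path with the same ends starts with a different arrow.
\<close>
lemma hasse_diagram_of_path_order:
  assumes G: "G \<subseteq> A \<times> A" and acyclic: "\<And>x. (x, x) \<notin> G\<^sup>+"
    and no_shortcut: "\<And>x y z. (x, y) \<in> G \<Longrightarrow> (x, z) \<in> G \<Longrightarrow> (z, y) \<in> G\<^sup>+ \<Longrightarrow> False"
  shows "\<exists>r. partial_order_on A r \<and> is_hasse_diagram_of G r"
proof (intro exI conjI)
  let ?r = "{(y, x). x \<in> A \<and> y \<in> A \<and> (x, y) \<in> G\<^sup>*}"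
  have anti: "x = y" if "(x, y) \<in> G\<^sup>*" "(y, x) \<in> G\<^sup>*" for x y
    using that acyclic by (metis rtranclD rtrancl_trancl_trancl)
  show "partial_order_on A ?r"
    unfolding partial_order_on_def preorder_on_def
    by (auto simp: refl_on_def intro!: transI antisymI anti intro: rtrancl_trans)
  have "(y, x) \<in> covering_relations ?r" if xy: "(x, y) \<in> G" for x y
  proof -
    have "x \<noteq> y" using acyclic xy by blast
    moreover have False
      if z: "z \<noteq> x" "z \<noteq> y" "(x, z) \<in> G\<^sup>*" "(z, y) \<in> G\<^sup>*" for z
    proof -
      obtain z' where "(x, z') \<in> G" "(z', z) \<in> G\<^sup>*" using z by (metis converse_rtranclE)
      moreover have "(z, y) \<in> G\<^sup>+" using z by (metis rtranclD)
      ultimately show False using no_shortcut[OF xy] by (metis rtrancl_trancl_trancl)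
    qed
    ultimately show ?thesis using xy G unfolding covering_relations_def by blast
  qed
  moreover have "(x, y) \<in> G" if "(y, x) \<in> covering_relations ?r" for x y
  proof -
    have xy: "(x, y) \<in> G\<^sup>*" "x \<noteq> y" and A: "x \<in> A" "y \<in> A"
      and cover: "\<not> (\<exists>z. z \<noteq> y \<and> z \<noteq> x \<and> (y, z) \<in> ?r \<and> (z, x) \<in> ?r)"
      using that unfolding covering_relations_def by blast+
    obtain z where z: "(x, z) \<in> G" "(z, y) \<in> G\<^sup>*" using xy by (metis converse_rtranclE)
    have "z \<noteq> x" using acyclic z(1) by blast
    moreover have "(z, x) \<in> ?r" "(y, z) \<in> ?r" using z A G by auto
    ultimately have "z = y" using cover by blast
    then show ?thesis using z by simp
  qed
  ultimately show "is_hasse_diagram_of G ?r"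
    unfolding is_hasse_diagram_of_def by auto
qed

theorem theorem1p7:
  fixes n :: nat and wh :: "nat \<Rightarrow> bool" and Q :: "nat set set"
  assumes "n \<ge> 1"
    and "alternating_colouring n wh"
    and "quadrangulation (blue n) n Q"
  shows "\<exists>r. partial_order_on (compatible_quadrangulations n wh Q) r \<and>
             is_hasse_diagram_of (flip_graph n wh Q) r"
proof -
  interpret flip_setting n wh Q by unfold_locales (use assms in auto)
  show ?thesis
  proof (rule hasse_diagram_of_path_order)
    show "flip_graph n wh Q \<subseteq> compat \<times> compat"
      unfolding flip_graph_def oriented_flip_def by blast
    show "(x, x) \<notin> (flip_graph n wh Q)\<^sup>+" for x
      using flip_path_shadow by blast
    show False if "(x, y) \<in> flip_graph n wh Q" "(x, z) \<in> flip_graph n wh Q"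
      "(z, y) \<in> (flip_graph n wh Q)\<^sup>+" for x y z
      using flip_no_shortcut[OF that] .
  qed
qed

end
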